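(* Let $A=[a_1,b_1]\times[a_2,b_2]$, $B=[b_1,c_1]\times[a_2,b_2]$ and $A\times_1B=[a_1,c_1]\times[a_2,b_2]$ with $a_1<b_1<c_1$ and $a_2<b_2$, and let $\alpha_1,\dots,\alpha_k$ be $2$-forms with continuous coefficients on $A\times_1B$ such that none of the iterated integrals defining $R_A$, $R_B$, $R_{A\times_1B}$, $R_{A,B}$ vanishes. Then $$i\big(J_{A\times_1B}(\alpha_1,\dots,\alpha_k)\big)=J_A(\alpha_1,\dots,\alpha_k)\times_1 J_B(\alpha_1,\dots,\alpha_k),$$ where the right side denotes the image of $J_A\otimes J_B$ under $\times_1$.
   Context: For a rectangle $C=[p_1,q_1]\times[p_2,q_2]$, $2$-forms $\beta_j=g_j\,dx\wedge dy$ and permutations $\sigma_1,\sigma_2$ of $\{1,\dots,n\}$, $I_C(\beta_1,\dots,\beta_n,\sigma_1,\sigma_2)$ is the integral of $\prod_j g_j(x_j,y_j)$ over $\{p_1\le x_{\sigma_1(1)}\le\dots\le x_{\sigma_1(n)}\le q_1\}\times\{p_2\le y_{\sigma_2(1)}\le\dots\le y_{\sigma_2(n)}\le q_2\}$; for $i\in\{0,\dots,n\}$, $I^i_{A\times_1B}(\beta_1,\dots,\beta_n,\sigma_1,\sigma_2)$ is the integral over $\{a_1\le x_{\sigma_1(1)}\le\dots\le x_{\sigma_1(i)}\le b_1\le x_{\sigma_1(i+1)}\le\dots\le x_{\sigma_1(n)}\le c_1\}\times\{a_2\le y_{\sigma_2(1)}\le\dots\le y_{\sigma_2(n)}\le b_2\}$.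 Words $M=(m_1,\dots,m_n)$ with $m_j\in\{1,\dots,k\}$, $\deg M=n$, $MN$ = concatenation; $I_C(M,\sigma_1,\sigma_2)=I_C(\alpha_{m_1},\dots,\alpha_{m_n},\sigma_1,\sigma_2)$, similarly $I^i_{A\times_1B}(M,\sigma_1,\sigma_2)$. Triples $(M,\sigma_1,\sigma_2)$ and $(M',\sigma'_1,\sigma'_2)$ are equivalent if for some permutation $\pi$, $m'_j=m_{\pi(j)}$ and $\sigma'_i=\pi^{-1}\circ\sigma_i$; each class has a unique representative with $\sigma_1=\mathrm{id}$. For $C\in\{A,B,A\times_1B\}$, $R_C$ is the completion (inverse limit over $n$ of quotients by the span of elements of degree $>n$) of the free $\mathbb Z$-module on symbols $r_C(M,\sigma_1,\sigma_2)$, one per class (degree-$0$ symbol $=1$), and $J_C(\alpha_1,\dots,\alpha_k)=\sum r_C(M,\sigma_1,\sigma_2)$ over all classes. $R_{A,B}$ is the analogous completion of the free $\mathbb Z$-module on symbols $r^i_{A,B}(M,\sigma_1,\sigma_2)$, one for each class and each $i\in\{0,\dots,\deg M\}$ (degree-$0$ symbol $=1$). For $\tau$ a permutation of $\{1,\dots,n\}$, $\tau^{+m}(m+j)=m+\tau(j)$; for $\sigma$ of $\{1,\dots,m\}$ and $\tau'$ of $\{m+1,\dots,m+n\}$, $\Sigma(\sigma)(\tau')$ is the set of permutations $\rho$ of $\{1,\dots,m+n\}$ whose value sequence contains $\sigma(1),\dots,\sigma(m)$ in order and $\tau'(m+1),\dots,\tau'(m+n)$ in order. The map $\times_1:R_A\hat\otimes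 R_B\to R_{A,B}$ is the continuous $\mathbb Z$-linear map with $r_A(M,\mathrm{id},\sigma_2)\otimes r_B(N,\mathrm{id},\tau_2)\mapsto\sum_{\rho_2\in\Sigma(\sigma_2)(\tau_2^{+m})} r^m_{A,B}(MN,\mathrm{id},\rho_2)$, $m=\deg M$. The map $i:R_{A\times_1B}\to R_{A,B}$ is the continuous $\mathbb Z$-linear map with $i(r_{A\times_1B}(M,\mathrm{id},\sigma_2))=\sum_{j=0}^{\deg M} r^j_{A,B}(M,\mathrm{id},\sigma_2)$. *)

theory Defs
  imports
    "HOL-Analysis.Analysis"
    "HOL-Algebra.Free_Abelian_Groups"
    "HOL-Combinatorics.Permutations"
    "HOL-Library.Sublist"
begin

section \<open>Iterated integrals over rectangles\<close>

text \<open>\<open>Rect p1 q1 p2 q2\<close> stands for \<open>[p1,q1] \<times> [p2,q2]\<close>.\<close>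

datatype rect = Rect (x_lo: real) (x_hi: real) (y_lo: real) (y_hi: real)

definition rect_set :: "rect \<Rightarrow> (real \<times> real) set" where
  "rect_set C = {x_lo C..x_hi C} \<times> {y_lo C..y_hi C}"

text \<open>\<open>A \<times>\<^sub>1 B\<close>, meant for \<open>x_hi A = x_lo B\<close> and equal y-ranges.\<close>

definition join1 :: "rect \<Rightarrow> rect \<Rightarrow> rect" where
  "join1 A B = Rect (x_lo A) (x_hi B) (y_lo A) (y_hi A)"

text \<open>A 2-form \<open>g dx \<and> dy\<close> is given by its coefficient \<open>g\<close>.\<close>

type_synonym two_form = "real \<times> real \<Rightarrow> real"

text \<open>Lebesgue measure in the variables \<open>z\<^sub>j = (x\<^sub>j, y\<^sub>j)\<close>, \<open>j = 1..n\<close>. For \<open>n = 0\<close> it is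
  the unit mass at a point, so the integrals below are \<open>1\<close> in degree 0.\<close>

definition config :: "nat \<Rightarrow> (nat \<Rightarrow> real \<times> real) measure" where
  "config n = Pi\<^sub>M {1..n} (\<lambda>_. lborel)"

definition iter_int ::
    "rect \<Rightarrow> nat \<Rightarrow> (nat \<Rightarrow> two_form) \<Rightarrow> (nat \<Rightarrow> nat) \<Rightarrow> (nat \<Rightarrow> nat) \<Rightarrow> real" where
  "iter_int C n \<beta> \<sigma>1 \<sigma>2 =
    (LINT z:{z \<in> space (config n).
        sorted ([x_lo C] @ map (\<lambda>j. fst (z (\<sigma>1 j))) [1..<Suc n] @ [x_hi C]) \<and>
        sorted ([y_lo C] @ map (\<lambda>j. snd (z (\<sigma>2 j))) [1..<Suc n] @ [y_hi C])} | config n.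
      \<Prod>j\<in>{1..n}. \<beta> j (z j))"

definition iter_int_split ::
    "nat \<Rightarrow> rect \<Rightarrow> rect \<Rightarrow> nat \<Rightarrow> (nat \<Rightarrow> two_form) \<Rightarrow> (nat \<Rightarrow> nat) \<Rightarrow> (nat \<Rightarrow> nat) \<Rightarrow> real" where
  "iter_int_split i A B n \<beta> \<sigma>1 \<sigma>2 =
    (LINT z:{z \<in> space (config n).
        sorted ([x_lo A] @ map (\<lambda>j. fst (z (\<sigma>1 j))) [1..<Suc i] @ [x_hi A]
                @ map (\<lambda>j. fst (z (\<sigma>1 j))) [Suc i..<Suc n] @ [x_hi B]) \<and>
        sorted ([y_lo A] @ map (\<lambda>j. snd (z (\<sigma>2 j))) [1..<Suc n] @ [y_hi A])} | config n.
      \<Prod>j\<in>{1..n}. \<beta> j (z j))"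

section \<open>Words, triples and their classes\<close>

text \<open>A word \<open>(m\<^sub>1,\<dots>,m\<^sub>n)\<close> is a list, so that \<open>m\<^sub>j = M ! (j - 1)\<close>.\<close>

type_synonym triple = "nat list \<times> (nat \<Rightarrow> nat) \<times> (nat \<Rightarrow> nat)"

definition triples :: "nat \<Rightarrow> triple set" where
  "triples k = {(M, \<sigma>1, \<sigma>2). set M \<subseteq> {1..k} \<and>
      \<sigma>1 permutes {1..length M} \<and> \<sigma>2 permutes {1..length M}}"

definition forms_of_word :: "(nat \<Rightarrow> two_form) \<Rightarrow> nat list \<Rightarrow> nat \<Rightarrow> two_form" where
  "forms_of_word \<alpha> M j = \<alpha> (M ! (j - 1))"

definition I_int ::
    "(nat \<Rightarrow> two_form) \<Rightarrow> rect \<Rightarrow> nat list \<Rightarrow> (nat \<Rightarrow> nat) \<Rightarrow> (nat \<Rightarrow> nat) \<Rightarrow> real" where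
  "I_int \<alpha> C M = iter_int C (length M) (forms_of_word \<alpha> M)"

definition I_split ::
    "(nat \<Rightarrow> two_form) \<Rightarrow> nat \<Rightarrow> rect \<Rightarrow> rect \<Rightarrow> nat list \<Rightarrow> (nat \<Rightarrow> nat) \<Rightarrow> (nat \<Rightarrow> nat) \<Rightarrow> real" where
  "I_split \<alpha> i A B M = iter_int_split i A B (length M) (forms_of_word \<alpha> M)"

text \<open>\<open>inv_into UNIV \<pi>\<close> is the inverse function of \<open>\<pi>\<close> (plain \<open>inv\<close> clashes with the group inverse).\<close>

definition triple_equiv :: "nat \<Rightarrow> (triple \<times> triple) set" where
  "triple_equiv k = {((M, \<sigma>1, \<sigma>2), (M', \<sigma>1', \<sigma>2')).
      (M, \<sigma>1, \<sigma>2) \<in> triples k \<and> (M', \<sigma>1', \<sigma>2') \<in> triples k \<and> length M' = length M \<and>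
      (\<exists>\<pi>. \<pi> permutes {1..length M} \<and>
        (\<forall>j\<in>{1..length M}. M' ! (j - 1) = M ! (\<pi> j - 1)) \<and>
        \<sigma>1' = inv_into UNIV \<pi> \<circ> \<sigma>1 \<and> \<sigma>2' = inv_into UNIV \<pi> \<circ> \<sigma>2)}"

definition triple_class ::
    "nat \<Rightarrow> nat list \<Rightarrow> (nat \<Rightarrow> nat) \<Rightarrow> (nat \<Rightarrow> nat) \<Rightarrow> triple set" where
  "triple_class k M \<sigma>1 \<sigma>2 = triple_equiv k `` {(M, \<sigma>1, \<sigma>2)}"

section \<open>Completions and completed tensor products of abelian groups\<close>

text \<open>Abelian groups are written multiplicatively, as in the library; a \<open>\<int>\<close>-linear map is a
  group homomorphism. For a decreasing sequence \<open>F\<close> of subgroups of \<open>G\<close>, the completion is the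
  inverse limit of the quotients \<open>G Mod F n\<close>: for \<open>m \<le> n\<close> the projection
  \<open>G Mod F n \<rightarrow> G Mod F m\<close> sends a coset \<open>X\<close> to the coset \<open>F m <#> X\<close>.\<close>

definition completion ::
    "('a, 'm) monoid_scheme \<Rightarrow> (nat \<Rightarrow> 'a set) \<Rightarrow> (nat \<Rightarrow> 'a set) monoid" where
  "completion G F = (product_group UNIV (\<lambda>n. G Mod F n))
     \<lparr>carrier := {x \<in> carrier (product_group UNIV (\<lambda>n. G Mod F n)).
                    \<forall>m n. m \<le> n \<longrightarrow> F m <#>\<^bsub>G\<^esub> x n = x m}\<rparr>"

definition completion_topology ::
    "('a, 'm) monoid_scheme \<Rightarrow> (nat \<Rightarrow> 'a set) \<Rightarrow> (nat \<Rightarrow> 'a set) topology" where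
  "completion_topology G F =
     subtopology (product_topology (\<lambda>n. discrete_topology (carrier (G Mod F n))) UNIV)
                 (carrier (completion G F))"

text \<open>The canonical map \<open>G \<rightarrow> completion G F\<close>.\<close>

definition to_completion ::
    "('a, 'm) monoid_scheme \<Rightarrow> (nat \<Rightarrow> 'a set) \<Rightarrow> 'a \<Rightarrow> nat \<Rightarrow> 'a set" where
  "to_completion G F g = (\<lambda>n. F n #>\<^bsub>G\<^esub> g)"

text \<open>The sum of a family that has, in each quotient \<open>G Mod F n\<close>, only finitely many nonzero
  members.\<close>

definition completion_sum ::
    "('a, 'm) monoid_scheme \<Rightarrow> (nat \<Rightarrow> 'a set) \<Rightarrow> ('s \<Rightarrow> nat \<Rightarrow> 'a set) \<Rightarrow> 's set \<Rightarrow> nat \<Rightarrow> 'a set" where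
  "completion_sum G F f S = (\<lambda>n. gfinprod (G Mod F n) (\<lambda>s. f s n) S)"

text \<open>The induced filtration: the kernel of the projection of the completion to \<open>G Mod F n\<close>.\<close>

definition completion_filt ::
    "('a, 'm) monoid_scheme \<Rightarrow> (nat \<Rightarrow> 'a set) \<Rightarrow> nat \<Rightarrow> (nat \<Rightarrow> 'a set) set" where
  "completion_filt G F n = {x \<in> carrier (completion G F). x n = \<one>\<^bsub>G Mod F n\<^esub>}"

text \<open>Continuous \<open>\<int>\<close>-linear maps between completions. They are taken to be \<open>undefined\<close> outside
  the carrier, so that a map is determined by its values on the carrier.\<close>

definition cont_linear ::
    "('a, 'm) monoid_scheme \<Rightarrow> (nat \<Rightarrow> 'a set) \<Rightarrow> ('b, 'l) monoid_scheme \<Rightarrow> (nat \<Rightarrow> 'b set) \<Rightarrow>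
     ((nat \<Rightarrow> 'a set) \<Rightarrow> (nat \<Rightarrow> 'b set)) set" where
  "cont_linear G F H E =
     {f \<in> hom (completion G F) (completion H E) \<inter> extensional (carrier (completion G F)).
        continuous_map (completion_topology G F) (completion_topology H E) f}"

text \<open>\<open>G \<otimes> H\<close> as the free abelian group on pairs modulo the bilinearity relations.\<close>

definition tensor_relations ::
    "('a, 'm) monoid_scheme \<Rightarrow> ('b, 'l) monoid_scheme \<Rightarrow> ('a \<times> 'b \<Rightarrow>\<^sub>0 int) set" where
  "tensor_relations G H =
     generate (free_Abelian_group (carrier G \<times> carrier H))
      ({frag_of (x \<otimes>\<^bsub>G\<^esub> x', y) - frag_of (x, y) - frag_of (x', y) | x x' y.
          x \<in> carrier G \<and> x' \<in> carrier G \<and> y \<in> carrier H} \<union>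
       {frag_of (x, y \<otimes>\<^bsub>H\<^esub> y') - frag_of (x, y) - frag_of (x, y') | x y y'.
          x \<in> carrier G \<and> y \<in> carrier H \<and> y' \<in> carrier H})"

definition tensor ::
    "('a, 'm) monoid_scheme \<Rightarrow> ('b, 'l) monoid_scheme \<Rightarrow> ('a \<times> 'b \<Rightarrow>\<^sub>0 int) set monoid" where
  "tensor G H = free_Abelian_group (carrier G \<times> carrier H) Mod tensor_relations G H"

definition pure_tensor ::
    "('a, 'm) monoid_scheme \<Rightarrow> ('b, 'l) monoid_scheme \<Rightarrow> 'a \<Rightarrow> 'b \<Rightarrow> ('a \<times> 'b \<Rightarrow>\<^sub>0 int) set" where
  "pure_tensor G H x y =
     tensor_relations G H #>\<^bsub>free_Abelian_group (carrier G \<times> carrier H)\<^esub> frag_of (x, y)"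

text \<open>For \<open>G\<close>, \<open>H\<close> filtered by \<open>F\<close>, \<open>E\<close>: the filtration
  \<open>F n \<otimes> H + G \<otimes> E n\<close> of \<open>G \<otimes> H\<close> (images in \<open>G \<otimes> H\<close>), whose \<open>n\<close>-th quotient is
  \<open>G/F n \<otimes> H/E n\<close>. The completed tensor product is the completion for it.\<close>

definition tensor_filt ::
    "('a, 'm) monoid_scheme \<Rightarrow> (nat \<Rightarrow> 'a set) \<Rightarrow> ('b, 'l) monoid_scheme \<Rightarrow> (nat \<Rightarrow> 'b set) \<Rightarrow>
     nat \<Rightarrow> ('a \<times> 'b \<Rightarrow>\<^sub>0 int) set set" where
  "tensor_filt G F H E n = generate (tensor G H)
     ({pure_tensor G H x y | x y. x \<in> F n \<and> y \<in> carrier H} \<union>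
      {pure_tensor G H x y | x y. x \<in> carrier G \<and> y \<in> E n})"

section \<open>The modules \<open>R\<^sub>C\<close> and \<open>R\<^sub>A\<^sub>,\<^sub>B\<close>\<close>

text \<open>The symbol \<open>r\<^sub>C(M,\<sigma>1,\<sigma>2)\<close> is the pair of the rectangle \<open>C\<close> and the class of the triple,
  and \<open>r\<^sup>i\<^sub>A\<^sub>,\<^sub>B(M,\<sigma>1,\<sigma>2)\<close> is the tuple of \<open>(A,B)\<close>, the class and \<open>i\<close>. The 2-forms enter the
  symbols through the indices of the words only. The degree 0 symbol (written 1) is an
  ordinary basis element; only the module structure is used here.\<close>

type_synonym sym = "rect \<times> triple set"
type_synonym split_sym = "(rect \<times> rect) \<times> triple set \<times> nat"

definition symbols :: "nat \<Rightarrow> rect \<Rightarrow> sym set" where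
  "symbols k C = {C} \<times> (triples k // triple_equiv k)"

definition split_symbols :: "nat \<Rightarrow> rect \<Rightarrow> rect \<Rightarrow> split_sym set" where
  "split_symbols k A B =
     {((A, B), triple_class k M \<sigma>1 \<sigma>2, i) | M \<sigma>1 \<sigma>2 i. (M, \<sigma>1, \<sigma>2) \<in> triples k \<and> i \<le> length M}"

definition r_sym ::
    "nat \<Rightarrow> rect \<Rightarrow> nat list \<Rightarrow> (nat \<Rightarrow> nat) \<Rightarrow> (nat \<Rightarrow> nat) \<Rightarrow> sym \<Rightarrow>\<^sub>0 int" where
  "r_sym k C M \<sigma>1 \<sigma>2 = frag_of (C, triple_class k M \<sigma>1 \<sigma>2)"

definition r_split_sym ::
    "nat \<Rightarrow> nat \<Rightarrow> rect \<Rightarrow> rect \<Rightarrow> nat list \<Rightarrow> (nat \<Rightarrow> nat) \<Rightarrow> (nat \<Rightarrow> nat) \<Rightarrow> split_sym \<Rightarrow>\<^sub>0 int" where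
  "r_split_sym k i A B M \<sigma>1 \<sigma>2 = frag_of ((A, B), triple_class k M \<sigma>1 \<sigma>2, i)"

abbreviation Free :: "nat \<Rightarrow> rect \<Rightarrow> (sym \<Rightarrow>\<^sub>0 int) monoid" where
  "Free k C \<equiv> free_Abelian_group (symbols k C)"

abbreviation Free_split :: "nat \<Rightarrow> rect \<Rightarrow> rect \<Rightarrow> (split_sym \<Rightarrow>\<^sub>0 int) monoid" where
  "Free_split k A B \<equiv> free_Abelian_group (split_symbols k A B)"

text \<open>The span of the elements of degree \<open>> n\<close>.\<close>

definition deg_filt :: "nat \<Rightarrow> rect \<Rightarrow> nat \<Rightarrow> (sym \<Rightarrow>\<^sub>0 int) set" where
  "deg_filt k C n = generate (Free k C)
     {r_sym k C M \<sigma>1 \<sigma>2 | M \<sigma>1 \<sigma>2. (M, \<sigma>1, \<sigma>2) \<in> triples k \<and> length M > n}"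

definition deg_filt_split :: "nat \<Rightarrow> rect \<Rightarrow> rect \<Rightarrow> nat \<Rightarrow> (split_sym \<Rightarrow>\<^sub>0 int) set" where
  "deg_filt_split k A B n = generate (Free_split k A B)
     {r_split_sym k i A B M \<sigma>1 \<sigma>2 | i M \<sigma>1 \<sigma>2.
        (M, \<sigma>1, \<sigma>2) \<in> triples k \<and> i \<le> length M \<and> length M > n}"

abbreviation R_mod :: "nat \<Rightarrow> rect \<Rightarrow> (nat \<Rightarrow> (sym \<Rightarrow>\<^sub>0 int) set) monoid" where
  "R_mod k C \<equiv> completion (Free k C) (deg_filt k C)"

abbreviation RAB_mod :: "nat \<Rightarrow> rect \<Rightarrow> rect \<Rightarrow> (nat \<Rightarrow> (split_sym \<Rightarrow>\<^sub>0 int) set) monoid" where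
  "RAB_mod k A B \<equiv> completion (Free_split k A B) (deg_filt_split k A B)"

abbreviation in_R :: "nat \<Rightarrow> rect \<Rightarrow> (sym \<Rightarrow>\<^sub>0 int) \<Rightarrow> nat \<Rightarrow> (sym \<Rightarrow>\<^sub>0 int) set" where
  "in_R k C \<equiv> to_completion (Free k C) (deg_filt k C)"

abbreviation in_RAB ::
    "nat \<Rightarrow> rect \<Rightarrow> rect \<Rightarrow> (split_sym \<Rightarrow>\<^sub>0 int) \<Rightarrow> nat \<Rightarrow> (split_sym \<Rightarrow>\<^sub>0 int) set" where
  "in_RAB k A B \<equiv> to_completion (Free_split k A B) (deg_filt_split k A B)"

definition J_sum :: "nat \<Rightarrow> rect \<Rightarrow> nat \<Rightarrow> (sym \<Rightarrow>\<^sub>0 int) set" where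
  "J_sum k C = completion_sum (Free k C) (deg_filt k C) (\<lambda>s. in_R k C (frag_of s)) (symbols k C)"

text \<open>The completed tensor product of \<open>R\<^sub>A\<close> and \<open>R\<^sub>B\<close> is
  \<open>completion (tensor (R_mod k A) (R_mod k B)) (tensor_RR_filt k A B)\<close>; \<open>ctensor\<close> is the image in it
  of a pure tensor.\<close>

definition tensor_RR_filt where
  "tensor_RR_filt k A B =
     tensor_filt (R_mod k A) (completion_filt (Free k A) (deg_filt k A))
                 (R_mod k B) (completion_filt (Free k B) (deg_filt k B))"

definition ctensor where
  "ctensor k A B x y =
     to_completion (tensor (R_mod k A) (R_mod k B)) (tensor_RR_filt k A B) (pure_tensor (R_mod k A) (R_mod k B) x y)"

section \<open>The maps \<open>\<times>\<^sub>1\<close> and \<open>i\<close>\<close>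

text \<open>\<open>shift_perm m \<tau>\<close> is \<open>\<tau>\<^sup>+\<^sup>m\<close>, extended by the identity on \<open>{..m}\<close>.\<close>

definition shift_perm :: "nat \<Rightarrow> (nat \<Rightarrow> nat) \<Rightarrow> nat \<Rightarrow> nat" where
  "shift_perm m \<tau> x = (if x \<le> m then x else m + \<tau> (x - m))"

definition shuffle_perms ::
    "nat \<Rightarrow> nat \<Rightarrow> (nat \<Rightarrow> nat) \<Rightarrow> (nat \<Rightarrow> nat) \<Rightarrow> (nat \<Rightarrow> nat) set" where
  "shuffle_perms m n \<sigma> \<tau>' = {\<rho>. \<rho> permutes {1..m+n} \<and>
      subseq (map \<sigma> [1..<Suc m]) (map \<rho> [1..<Suc (m+n)]) \<and>
      subseq (map \<tau>' [Suc m..<Suc (m+n)]) (map \<rho> [1..<Suc (m+n)])}"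

definition times1 where
  "times1 k A B = (THE f.
     f \<in> cont_linear (tensor (R_mod k A) (R_mod k B)) (tensor_RR_filt k A B)
                     (Free_split k A B) (deg_filt_split k A B) \<and>
     (\<forall>M \<sigma>2 N \<tau>2. (M, id, \<sigma>2) \<in> triples k \<and> (N, id, \<tau>2) \<in> triples k \<longrightarrow>
        f (ctensor k A B (in_R k A (r_sym k A M id \<sigma>2)) (in_R k B (r_sym k B N id \<tau>2))) =
        in_RAB k A B
          (\<Sum>\<rho>2 \<in> shuffle_perms (length M) (length N) \<sigma>2 (shift_perm (length M) \<tau>2).
             r_split_sym k (length M) A B (M @ N) id \<rho>2)))"

definition incl :: "nat \<Rightarrow> rect \<Rightarrow> rect \<Rightarrow>
    (nat \<Rightarrow> (sym \<Rightarrow>\<^sub>0 int) set) \<Rightarrow> nat \<Rightarrow> (split_sym \<Rightarrow>\<^sub>0 int) set" where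
  "incl k A B = (THE f.
     f \<in> cont_linear (Free k (join1 A B)) (deg_filt k (join1 A B))
                     (Free_split k A B) (deg_filt_split k A B) \<and>
     (\<forall>M \<sigma>2. (M, id, \<sigma>2) \<in> triples k \<longrightarrow>
        f (in_R k (join1 A B) (r_sym k (join1 A B) M id \<sigma>2)) =
        in_RAB k A B (\<Sum>j\<in>{0..length M}. r_split_sym k j A B M id \<sigma>2)))"

end

(* The completion of a free module graded by a degree with finitely many basis elements in each
   degree is the group of all integer-valued functions on the basis, so continuous linear maps into
   it can be given coefficient by coefficient. Both \<open>i\<close> and \<open>\<times>\<^sub>1\<close> are of this
   kind, and they are unique because the symbols (and their pure tensors) span a dense subgroup. The
   coefficient of \<open>r\<^sup>j(W, id, \<rho>)\<close> in \<open>i(J)\<close> is visibly 1. In \<open>J\<^sub>A \<times>\<^sub>1 J\<^sub>B\<close>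
   it is the number of pairs of symbols whose shuffle product contains \<open>r\<^sup>j(W, id, \<rho>)\<close>, and there
   is exactly one: cut \<open>W\<close> at \<open>j\<close> and separate the values of \<open>\<rho>\<close> that are \<open>\<le> j\<close> from those \<open>> j\<close>. *)
theory Submission
  imports Defs
begin

section \<open>Completions of filtered abelian groups\<close>

text \<open>Both maps are given by definite descriptions, so their values are known only after
  existence and uniqueness. The values at J are not among the prescribed ones: J is in general an
  infinite sum, and J_A tensor J_B is not a finite combination of tensors of symbols. The way around
  is dual. For each target symbol s of degree n one builds a homomorphism to the integers that looks
  only at level n of its argument. For \<open>incl\<close> it is a single coefficient. For
  \<open>times1\<close> it is the product of a coefficient on the left and one on the right, a
  single product because s arises from just one pair. It is defined on tensors by bilinearity,
  vanishes on step n of the filtration because both pieces have degree at most n, and therefore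
  descends to the completed tensor product. Dependence on level n alone is also what makes the
  assembled map continuous.\<close>

locale filtered_group = comm_group G for G (structure) +
  fixes F :: "nat \<Rightarrow> 'a set"
  assumes subgroup_filt: "subgroup (F n) G"
    and filt_antimono: "m \<le> n \<Longrightarrow> F n \<subseteq> F m"
begin

lemma normal_filt: "F n \<lhd> G"
  using subgroup_filt subgroup_imp_normal by blast

lemma comm_group_quotient: "comm_group (G Mod F n)"
  using subgroup_filt abelian_FactGroup by blast

lemma rcos_mult_filt:
  "\<lbrakk>x \<in> carrier G; y \<in> carrier G\<rbrakk> \<Longrightarrow> (F n #> x) <#> (F n #> y) = F n #> (x \<otimes> y)"
  using normal.rcos_sum[OF normal_filt] .

lemma rcos_filt_eq_iff:
  assumes "x \<in> carrier G" "y \<in> carrier G"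
  shows "F n #> x = F n #> y \<longleftrightarrow> x \<otimes> inv y \<in> F n"
proof
  assume "F n #> x = F n #> y"
  then have "x \<in> F n #> y" using rcos_self[OF assms(1) subgroup_filt, of n] by simp
  then show "x \<otimes> inv y \<in> F n" using subgroup.rcos_module[OF subgroup_filt is_group] assms by blast
next
  assume "x \<otimes> inv y \<in> F n"
  then have "x \<in> F n #> y" using subgroup.rcos_module[OF subgroup_filt is_group] assms by blast
  then show "F n #> x = F n #> y" using repr_independence[OF _ assms(2) subgroup_filt] by simp
qed

text \<open>In \<open>completion\<close> the projection from level n to level m is the set product
  with F m. Since F n lies in F m, it keeps the representative; compatibility checks are done in
  this form.\<close>

lemma filt_set_mult_rcos:
  assumes "m \<le> n" "x \<in> carrier G"
  shows "F m <#> (F n #> x) = F m #> x"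
proof -
  have s: "F m \<subseteq> carrier G" "F n \<subseteq> carrier G" using subgroup_filt subgroup.subset by blast+
  have "F m <#> F n = F m"
  proof
    show "F m <#> F n \<subseteq> F m"
      using filt_antimono[OF assms(1)] subgroup.m_closed[OF subgroup_filt]
      by (auto simp: set_mult_def)
    show "F m \<subseteq> F m <#> F n"
      using subgroup.one_closed[OF subgroup_filt, of n] s by (force simp: set_mult_def)
  qed
  then show ?thesis
    using setmult_rcos_assoc[OF s assms(2)] by simp
qed

lemma carrier_completion:
  "carrier (completion G F) =
     {x. (\<forall>n. x n \<in> carrier (G Mod F n)) \<and> (\<forall>m n. m \<le> n \<longrightarrow> F m <#> x n = x m)}"
  by (auto simp: completion_def)

lemma mult_completion: "x \<otimes>\<^bsub>completion G F\<^esub> y = (\<lambda>n. x n <#> y n)"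
  by (simp add: completion_def fun_eq_iff)

lemma one_completion: "\<one>\<^bsub>completion G F\<^esub> = F"
  by (simp add: completion_def restrict_def)

lemma completionE:
  assumes "x \<in> carrier (completion G F)"
  obtains g where "g \<in> carrier G" "x n = F n #> g"
proof -
  have "x n \<in> (\<lambda>g. F n #> g) ` carrier G"
    using assms by (simp add: carrier_completion carrier_FactGroup)
  then show ?thesis using that by blast
qed

lemma completion_restrict:
  assumes "x \<in> carrier (completion G F)" "m \<le> n" "g \<in> carrier G" "x n = F n #> g"
  shows "x m = F m #> g"
  using assms filt_set_mult_rcos[OF assms(2,3)] by (simp add: carrier_completion) metis

lemma completion_eq_restrict:
  assumes "x \<in> carrier (completion G F)" "y \<in> carrier (completion G F)" "m \<le> n" "x n = y n"
  shows "x m = y m"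
  using assms by (simp add: carrier_completion) metis

lemma to_completion_closed: "g \<in> carrier G \<Longrightarrow> to_completion G F g \<in> carrier (completion G F)"
  by (auto simp: carrier_completion to_completion_def carrier_FactGroup filt_set_mult_rcos)

lemma comm_group_completion: "comm_group (completion G F)"
proof (rule comm_groupI)
  interpret Q: comm_group "G Mod F n" for n by (rule comm_group_quotient)
  show "x \<otimes>\<^bsub>completion G F\<^esub> y \<in> carrier (completion G F)"
    if x: "x \<in> carrier (completion G F)" and y: "y \<in> carrier (completion G F)" for x y
    unfolding carrier_completion mult_completion mem_Collect_eq
  proof (intro conjI allI impI)
    fix n show "x n <#> y n \<in> carrier (G Mod F n)"
      using x y Q.m_closed[of "x n" n "y n"] by (simp add: carrier_completion)
    fix m assume "m \<le> n"
    obtain g where g: "g \<in> carrier G" "x n = F n #> g" by (rule completionE[OF x])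
    obtain h where h: "h \<in> carrier G" "y n = F n #> h" by (rule completionE[OF y])
    note g h
    moreover have "x m = F m #> g" "y m = F m #> h"
      using completion_restrict[OF x \<open>m \<le> n\<close> g] completion_restrict[OF y \<open>m \<le> n\<close> h] .
    ultimately show "F m <#> (x n <#> y n) = x m <#> y m"
      using \<open>m \<le> n\<close> by (simp add: rcos_mult_filt filt_set_mult_rcos)
  qed
  show "\<one>\<^bsub>completion G F\<^esub> \<in> carrier (completion G F)"
    using to_completion_closed[OF one_closed] subgroup.subset[OF subgroup_filt]
    by (simp add: to_completion_def one_completion)
  show "x \<otimes>\<^bsub>completion G F\<^esub> y \<otimes>\<^bsub>completion G F\<^esub> z = x \<otimes>\<^bsub>completion G F\<^esub> (y \<otimes>\<^bsub>completion G F\<^esub> z)"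
    if "x \<in> carrier (completion G F)" "y \<in> carrier (completion G F)" "z \<in> carrier (completion G F)"
    for x y z
    using that Q.m_assoc[of "x n" n "y n" "z n" for n] by (simp add: carrier_completion mult_completion)
  show "x \<otimes>\<^bsub>completion G F\<^esub> y = y \<otimes>\<^bsub>completion G F\<^esub> x"
    if "x \<in> carrier (completion G F)" "y \<in> carrier (completion G F)" for x y
    using that Q.m_comm[of "x n" n "y n" for n] by (simp add: carrier_completion mult_completion)
  show "\<one>\<^bsub>completion G F\<^esub> \<otimes>\<^bsub>completion G F\<^esub> x = x" if "x \<in> carrier (completion G F)" for x
    using that Q.l_one[of "x n" n for n] by (simp add: carrier_completion mult_completion one_completion)
  show "\<exists>y\<in>carrier (completion G F). y \<otimes>\<^bsub>completion G F\<^esub> x = \<one>\<^bsub>completion G F\<^esub>"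
    if x: "x \<in> carrier (completion G F)" for x
  proof
    let ?y = "\<lambda>n. inv\<^bsub>G Mod F n\<^esub> x n"
    show "?y \<otimes>\<^bsub>completion G F\<^esub> x = \<one>\<^bsub>completion G F\<^esub>"
      using x Q.l_inv[of "x n" n for n] by (simp add: carrier_completion mult_completion one_completion)
    \<comment> \<open>Inverses are taken level by level; writing two levels with the same
      representative g shows that they are compatible.\<close>
    have inv: "?y n = F n #> inv g" if "g \<in> carrier G" "x n = F n #> g" for n g
      using that x normal.inv_FactGroup[OF normal_filt, of "F n #> g" n] normal.rcos_inv[OF normal_filt, of g n]
      by (simp add: carrier_FactGroup)
    show "?y \<in> carrier (completion G F)"
      unfolding carrier_completion mem_Collect_eq
    proof (intro conjI allI impI)
      fix n show "?y n \<in> carrier (G Mod F n)"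
        using x Q.inv_closed[of "x n" n] by (simp add: carrier_completion)
      fix m assume "m \<le> n"
      obtain g where g: "g \<in> carrier G" "x n = F n #> g" by (rule completionE[OF x])
      note g
      moreover have "x m = F m #> g"
        using completion_restrict[OF x \<open>m \<le> n\<close> g] .
      ultimately show "F m <#> ?y n = ?y m"
        using \<open>m \<le> n\<close> inv[of g n] inv[of g m] by (simp add: filt_set_mult_rcos)
    qed
  qed
qed

lemma proj_completion_hom: "(\<lambda>x. x n) \<in> hom (completion G F) (G Mod F n)"
  by (rule homI) (auto simp: carrier_completion mult_completion)

lemma to_completion_hom: "to_completion G F \<in> hom G (completion G F)"
  by (rule homI) (use to_completion_closed in \<open>auto simp: mult_completion to_completion_def rcos_mult_filt\<close>)

section \<open>Topology of the completion\<close>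

lemma topspace_completion: "topspace (completion_topology G F) = carrier (completion G F)"
  by (auto simp: completion_topology_def carrier_completion)

lemma Hausdorff_completion: "Hausdorff_space (completion_topology G F)"
  unfolding completion_topology_def
  by (intro Hausdorff_space_subtopology) (simp add: Hausdorff_space_product_topology)

lemma completion_filt_subgroup: "subgroup (completion_filt G F n) (completion G F)"
proof -
  interpret C: comm_group "completion G F" by (rule comm_group_completion)
  interpret Q: comm_group "G Mod F n" by (rule comm_group_quotient)
  interpret h: group_hom "completion G F" "G Mod F n" "\<lambda>x. x n"
    by unfold_locales (rule proj_completion_hom)
  show ?thesis
    using h.subgroup_kernel by (simp add: completion_filt_def kernel_def)
qed

text \<open>The component at level n determines all lower ones, so the kernels decrease. This
  filtration is what lets a tensor product of two completions be completed again.\<close>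

lemma filtered_completion: "filtered_group (completion G F) (completion_filt G F)"
proof -
  interpret C: comm_group "completion G F" by (rule comm_group_completion)
  show ?thesis
  proof (intro filtered_group.intro filtered_group_axioms.intro comm_group_completion)
    show "subgroup (completion_filt G F n) (completion G F)" for n
      by (rule completion_filt_subgroup)
    show "completion_filt G F n \<subseteq> completion_filt G F m" if "m \<le> n" for m n
    proof
      fix x assume "x \<in> completion_filt G F n"
      then have "x \<in> carrier (completion G F)" "x n = \<one>\<^bsub>completion G F\<^esub> n"
        by (auto simp: completion_filt_def one_completion)
      with completion_eq_restrict[OF _ C.one_closed \<open>m \<le> n\<close>, of x]
      show "x \<in> completion_filt G F m" by (simp add: completion_filt_def one_completion)
    qed
  qed
qed

text \<open>A basic open neighbourhood restricts only finitely many levels, and agreement at the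
  largest of them forces agreement at all lower ones.\<close>

lemma in_closure_of_completion:
  assumes x: "x \<in> carrier (completion G F)" and D: "D \<subseteq> carrier (completion G F)"
    and appr: "\<And>n. \<exists>d\<in>D. d n = x n"
  shows "x \<in> completion_topology G F closure_of D"
  unfolding in_closure_of topspace_completion
proof (intro conjI allI impI x)
  fix T assume T: "x \<in> T \<and> openin (completion_topology G F) T"
  then obtain U where U: "openin (product_topology (\<lambda>n. discrete_topology (carrier (G Mod F n))) UNIV) U"
    "T = U \<inter> carrier (completion G F)"
    by (auto simp: completion_topology_def openin_subtopology)
  then obtain V where V: "finite {i. V i \<noteq> topspace (discrete_topology (carrier (G Mod F i)))}"
    "x \<in> Pi\<^sub>E UNIV V" "Pi\<^sub>E UNIV V \<subseteq> U"
    using T by (auto simp: openin_product_topology_alt)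
  let ?I = "{i. V i \<noteq> carrier (G Mod F i)}"
  have fin: "finite ?I" using V by simp
  \<comment> \<open>\<open>insert 0\<close> keeps \<open>Max\<close> meaningful when no level is
    restricted.\<close>
  define n where "n = Max (insert 0 ?I)"
  have n: "i \<le> n" if "V i \<noteq> carrier (G Mod F i)" for i
    using that fin by (simp add: n_def)
  obtain d where d: "d \<in> D" "d n = x n" using appr by blast
  have "d i \<in> V i" for i
  proof (cases "V i = carrier (G Mod F i)")
    case True then show ?thesis using d D by (auto simp: carrier_completion)
  next
    case False
    then have "d i = x i" using completion_eq_restrict d D x n by blast
    then show ?thesis using V(2) by auto
  qed
  then have "d \<in> U" using V(3) by auto
  then show "\<exists>y. y \<in> D \<and> y \<in> T" using d D U by blast
qed

text \<open>\<open>dep\<close> says that level n of the image depends on level n of the argument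
  alone. This is stronger than continuity, and it is available here because a coefficient of degree
  d of the image will be read off level d of the argument.\<close>

lemma cont_linear_onI:
  assumes H: "filtered_group H E" and hom: "f \<in> hom (completion G F) (completion H E)"
    and ext: "f \<in> extensional (carrier (completion G F))"
    and dep: "\<And>x y n. \<lbrakk>x \<in> carrier (completion G F); y \<in> carrier (completion G F); x n = y n\<rbrakk>
      \<Longrightarrow> f x n = f y n"
  shows "f \<in> cont_linear G F H E"
proof -
  interpret H: filtered_group H E by fact
  let ?C = "carrier (completion G F)"
  have closed: "f x \<in> carrier (completion H E)" if "x \<in> ?C" for x
    using hom that by (auto simp: hom_def)
  have "continuous_map (completion_topology G F) (discrete_topology (carrier (H Mod E n))) (\<lambda>x. f x n)"
    for n
  proof -
    have proj: "continuous_map (completion_topology G F) (discrete_topology (carrier (G Mod F n))) (\<lambda>x. x n)"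
      unfolding completion_topology_def
      by (intro continuous_map_from_subtopology continuous_map_product_projection) simp
    show ?thesis
      unfolding continuous_map_def topspace_completion
    proof (intro conjI allI impI)
      show "(\<lambda>x. f x n) \<in> ?C \<rightarrow> topspace (discrete_topology (carrier (H Mod E n)))"
        using closed by (simp add: H.carrier_completion)
      fix U
      \<comment> \<open>By \<open>dep\<close> the preimage is a union of fibres of the projection to
        level n, hence the preimage of a set in a discrete space.\<close>
      have "{x \<in> ?C. f x n \<in> U} = {x \<in> ?C. x n \<in> (\<lambda>x. x n) ` {x \<in> ?C. f x n \<in> U}}"
      proof (intro equalityI subsetI)
        fix x assume x: "x \<in> {x \<in> ?C. x n \<in> (\<lambda>x. x n) ` {x \<in> ?C. f x n \<in> U}}"
        then obtain y where "y \<in> ?C" "f y n \<in> U" "x n = y n" by auto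
        with x show "x \<in> {x \<in> ?C. f x n \<in> U}" using dep[of x y n] by simp
      qed auto
      moreover have "(\<lambda>x. x n) ` {x \<in> ?C. f x n \<in> U} \<subseteq> carrier (G Mod F n)"
        by (auto simp: carrier_completion)
      ultimately show "openin (completion_topology G F) {x \<in> ?C. f x n \<in> U}"
        using openin_continuous_map_preimage[OF proj, of "(\<lambda>x. x n) ` {x \<in> ?C. f x n \<in> U}"]
        by (simp add: topspace_completion)
    qed
  qed
  then have "continuous_map (completion_topology G F)
      (product_topology (\<lambda>n. discrete_topology (carrier (H Mod E n))) UNIV) f"
    by (subst continuous_map_componentwise_UNIV) simp
  then have "continuous_map (completion_topology G F) (completion_topology H E) f"
    unfolding completion_topology_def[of H]
    by (rule continuous_map_into_subtopology) (use closed in \<open>simp add: topspace_completion\<close>)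
  then show ?thesis using hom ext by (simp add: cont_linear_def)
qed

text \<open>Homomorphisms equal on D are equal on the subgroup it generates, and continuous maps
  into a Hausdorff space that agree on a dense set agree. Density is asked for one coset at a time,
  since every level of an element of the completion is the coset of some t in G. Off the carrier the
  maps agree because both are extensional.\<close>

lemma cont_linear_unique:
  assumes H: "filtered_group H E"
    and f: "f \<in> cont_linear G F H E" and g: "g \<in> cont_linear G F H E"
    and D: "D \<subseteq> carrier (completion G F)"
    and eq: "\<And>d. d \<in> D \<Longrightarrow> f d = g d"
    and dense: "\<And>t n. t \<in> carrier G \<Longrightarrow> \<exists>d\<in>generate (completion G F) D. d n = F n #> t"
  shows "f = g"
proof -
  interpret H: filtered_group H E by fact
  interpret C: comm_group "completion G F" by (rule comm_group_completion)
  interpret CH: comm_group "completion H E" by (rule H.comm_group_completion)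
  interpret f: group_hom "completion G F" "completion H E" f
    using f by unfold_locales (simp add: cont_linear_def)
  interpret g: group_hom "completion G F" "completion H E" g
    using g by unfold_locales (simp add: cont_linear_def)
  have "f d = g d" if "d \<in> generate (completion G F) D" for d
    using that
  proof induction
    case (eng h1 h2)
    then show ?case using C.generate_in_carrier[OF D] by simp
  qed (use D eq in auto)
  moreover have "x \<in> completion_topology G F closure_of (generate (completion G F) D)"
    if x: "x \<in> carrier (completion G F)" for x
  proof (rule in_closure_of_completion[OF that C.generate_incl[OF D]])
    fix n
    obtain t where "t \<in> carrier G" "x n = F n #> t" by (rule completionE[OF x])
    then show "\<exists>d\<in>generate (completion G F) D. d n = x n" using dense[of t n] by simp
  qed
  ultimately have "f x = g x" if "x \<in> carrier (completion G F)" for x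
    using that f g forall_in_closure_of_eq[OF _ H.Hausdorff_completion, of x "completion_topology G F" "generate (completion G F) D" f g]
    by (simp add: cont_linear_def)
  moreover have "f \<in> extensional (carrier (completion G F))" "g \<in> extensional (carrier (completion G F))"
    using f g by (auto simp: cont_linear_def)
  ultimately show ?thesis using extensionalityI by blast
qed

end

section \<open>Graded free abelian groups\<close>

lemma (in group_hom) subgroup_vimage:
  assumes "subgroup K H"
  shows "subgroup {x \<in> carrier G. h x \<in> K} G"
proof -
  interpret K: subgroup K H by fact
  show ?thesis by (rule G.subgroupI) (auto intro: exI[of _ "\<one>"])
qed

text \<open>The elements that f sends into P form a subgroup, so basis elements suffice. This is the
  induction behind both density proofs and behind \<open>tensor_subgroup_eqI\<close>.\<close>

lemma hom_free_Abelian_group_in_subgroup: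
  assumes "f \<in> hom (free_Abelian_group S) K" "group K" "subgroup P K"
    and gen: "\<And>s. s \<in> S \<Longrightarrow> f (frag_of s) \<in> P" and g: "Poly_Mapping.keys g \<subseteq> S"
  shows "f g \<in> P"
proof -
  interpret group_hom "free_Abelian_group S" K f
    using assms by (intro group_hom.intro group_hom_axioms.intro group_free_Abelian_group)
  interpret V: subgroup "{x \<in> carrier (free_Abelian_group S). f x \<in> P}" "free_Abelian_group S"
    by (rule subgroup_vimage) fact
  have "Poly_Mapping.keys g \<subseteq> S \<and> f g \<in> P"
  proof (rule free_Abelian_group_induct[OF g])
    show "Poly_Mapping.keys 0 \<subseteq> S \<and> f 0 \<in> P" using V.one_closed by simp
    fix a b assume a: "Poly_Mapping.keys a \<subseteq> S" "Poly_Mapping.keys a \<subseteq> S \<and> f a \<in> P"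
      and b: "Poly_Mapping.keys b \<subseteq> S" "Poly_Mapping.keys b \<subseteq> S \<and> f b \<in> P"
    then show "Poly_Mapping.keys (a - b) \<subseteq> S \<and> f (a - b) \<in> P"
      using V.m_closed[OF _ V.m_inv_closed, of a b] by simp
  qed (simp add: gen)
  then show ?thesis ..
qed

text \<open>As for power series in finitely many variables, finiteness in bounded degree is what
  makes every family of coefficients define an element of the completion.\<close>

locale graded_free_group =
  fixes S :: "'s set" and deg :: "'s \<Rightarrow> nat" and F :: "nat \<Rightarrow> ('s \<Rightarrow>\<^sub>0 int) set"
  assumes finite_deg: "finite {s \<in> S. deg s \<le> n}"
    and filt_generate: "F n = generate (free_Abelian_group S) (frag_of ` {s \<in> S. n < deg s})"
begin

abbreviation "G \<equiv> free_Abelian_group S"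

text \<open>The generators belong to the basis, so membership in the subgroup they generate is a
  condition on the support.\<close>

lemma filt_iff: "g \<in> F n \<longleftrightarrow> Poly_Mapping.keys g \<subseteq> {s \<in> S. n < deg s}"
proof
  assume "g \<in> F n"
  then show "Poly_Mapping.keys g \<subseteq> {s \<in> S. n < deg s}"
    unfolding filt_generate
  proof induction
    case (eng h1 h2)
    then show ?case using keys_add[of h1 h2] by auto
  qed auto
next
  have sub: "frag_of ` {s \<in> S. n < deg s} \<subseteq> carrier G" by auto
  interpret group G by simp
  interpret H: subgroup "F n" G
    unfolding filt_generate by (rule generate_is_subgroup[OF sub])
  assume "Poly_Mapping.keys g \<subseteq> {s \<in> S. n < deg s}"
  then show "g \<in> F n"
  proof (induction g rule: frag_induction)
    case zero
    then show ?case using H.one_closed by simp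
  next
    case (one s)
    then show ?case unfolding filt_generate by (auto intro: generate.incl)
  next
    case (diff x y)
    have "Poly_Mapping.keys y \<subseteq> S" using subsetD[OF H.subset diff(2)] by simp
    then show ?case
      using H.m_closed[OF diff(1) H.m_inv_closed[OF diff(2)]] by simp
  qed
qed

sublocale fg: filtered_group G F
proof (intro filtered_group.intro filtered_group_axioms.intro abelian_free_Abelian_group)
  show "subgroup (F n) G" for n
    unfolding filt_generate by (rule group.generate_is_subgroup) auto
  show "F n \<subseteq> F m" if "m \<le> n" for m n
    using that by (fastforce simp: filt_iff)
qed

lemma rcos_eq_iff:
  assumes "Poly_Mapping.keys x \<subseteq> S" "Poly_Mapping.keys y \<subseteq> S"
  shows "F n #>\<^bsub>G\<^esub> x = F n #>\<^bsub>G\<^esub> y \<longleftrightarrow>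
    (\<forall>s\<in>S. deg s \<le> n \<longrightarrow> Poly_Mapping.lookup x s = Poly_Mapping.lookup y s)"
proof -
  have "F n #>\<^bsub>G\<^esub> x = F n #>\<^bsub>G\<^esub> y \<longleftrightarrow> x - y \<in> F n"
    using fg.rcos_filt_eq_iff[of x y n] assms by simp
  moreover have "Poly_Mapping.keys (x - y) \<subseteq> S" using keys_diff[of x y] assms by blast
  then have "x - y \<in> F n \<longleftrightarrow> (\<forall>s\<in>S. deg s \<le> n \<longrightarrow> Poly_Mapping.lookup (x - y) s = 0)"
    unfolding filt_iff subset_iff in_keys_iff by (auto simp: not_le[symmetric])
  ultimately show ?thesis by (simp add: lookup_minus)
qed

text \<open>The coordinate at s is read at level \<open>deg s\<close>, the lowest level at which s
  is not killed. For s in S the choice of representative does not matter by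
  \<open>rcos_eq_iff\<close>, and every higher level gives the same value by
  \<open>coeff_eq_lookup\<close>.\<close>

definition coeff :: "(nat \<Rightarrow> ('s \<Rightarrow>\<^sub>0 int) set) \<Rightarrow> 's \<Rightarrow> int" where
  "coeff x s = Poly_Mapping.lookup
     (SOME g. Poly_Mapping.keys g \<subseteq> S \<and> x (deg s) = F (deg s) #>\<^bsub>G\<^esub> g) s"

lemma coeff_eq_lookup:
  assumes x: "x \<in> carrier (completion G F)" and g: "Poly_Mapping.keys g \<subseteq> S" "x n = F n #>\<^bsub>G\<^esub> g"
    and s: "s \<in> S" "deg s \<le> n"
  shows "coeff x s = Poly_Mapping.lookup g s"
proof -
  have *: "Poly_Mapping.keys g \<subseteq> S \<and> x (deg s) = F (deg s) #>\<^bsub>G\<^esub> g"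
    using fg.completion_restrict[OF x s(2) _ g(2)] g(1) by simp
  define h where "h = (SOME g. Poly_Mapping.keys g \<subseteq> S \<and> x (deg s) = F (deg s) #>\<^bsub>G\<^esub> g)"
  have "Poly_Mapping.keys h \<subseteq> S \<and> x (deg s) = F (deg s) #>\<^bsub>G\<^esub> h"
    unfolding h_def using someI[where P = "\<lambda>g. Poly_Mapping.keys g \<subseteq> S \<and> x (deg s) = F (deg s) #>\<^bsub>G\<^esub> g", OF *] .
  then show ?thesis
    using * rcos_eq_iff[of h g "deg s"] s(1) by (simp add: coeff_def h_def)
qed

text \<open>Immediate because only one level is read; it supplies the locality from which the
  continuity of \<open>incl\<close> is derived.\<close>

lemma coeff_local: "x (deg s) = y (deg s) \<Longrightarrow> coeff x s = coeff y s"
  by (simp add: coeff_def)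

lemma coeff_to_completion:
  assumes "Poly_Mapping.keys g \<subseteq> S" "s \<in> S"
  shows "coeff (to_completion G F g) s = Poly_Mapping.lookup g s"
  by (rule coeff_eq_lookup[OF _ assms(1) _ assms(2) order_refl])
    (use assms fg.to_completion_closed in \<open>auto simp: to_completion_def\<close>)

lemma completion_repr:
  assumes "x \<in> carrier (completion G F)"
  obtains g where "Poly_Mapping.keys g \<subseteq> S" "x n = F n #>\<^bsub>G\<^esub> g"
  by (rule fg.completionE[OF assms, of n]) simp

lemma coeff_mult:
  assumes x: "x \<in> carrier (completion G F)" and y: "y \<in> carrier (completion G F)" and s: "s \<in> S"
  shows "coeff (x \<otimes>\<^bsub>completion G F\<^esub> y) s = coeff x s + coeff y s"
proof -
  interpret C: comm_group "completion G F" by (rule fg.comm_group_completion)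
  obtain g where g: "Poly_Mapping.keys g \<subseteq> S" "x (deg s) = F (deg s) #>\<^bsub>G\<^esub> g"
    using completion_repr[OF x] .
  obtain h where h: "Poly_Mapping.keys h \<subseteq> S" "y (deg s) = F (deg s) #>\<^bsub>G\<^esub> h"
    using completion_repr[OF y] .
  have k: "Poly_Mapping.keys (g + h) \<subseteq> S" using keys_add[of g h] g h by blast
  have e: "(x \<otimes>\<^bsub>completion G F\<^esub> y) (deg s) = F (deg s) #>\<^bsub>G\<^esub> (g + h)"
    using g h fg.rcos_mult_filt[of g h "deg s"] by (simp add: fg.mult_completion)
  show ?thesis
    using coeff_eq_lookup[OF C.m_closed[OF x y] k e s order_refl]
      coeff_eq_lookup[OF x g s order_refl] coeff_eq_lookup[OF y h s order_refl]
    by (simp add: lookup_add)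
qed

text \<open>One half of the identification of the completion with functions on S;
  \<open>series_closed\<close> and \<open>coeff_series\<close> are the other half.\<close>

lemma completion_eqI:
  assumes x: "x \<in> carrier (completion G F)" and y: "y \<in> carrier (completion G F)"
    and eq: "\<And>s. s \<in> S \<Longrightarrow> coeff x s = coeff y s"
  shows "x = y"
proof
  fix n
  obtain g where g: "Poly_Mapping.keys g \<subseteq> S" "x n = F n #>\<^bsub>G\<^esub> g" using completion_repr[OF x] .
  obtain h where h: "Poly_Mapping.keys h \<subseteq> S" "y n = F n #>\<^bsub>G\<^esub> h" using completion_repr[OF y] .
  show "x n = y n"
    unfolding g h rcos_eq_iff[OF g(1) h(1)]
    using coeff_eq_lookup[OF x g] coeff_eq_lookup[OF y h] eq by simp
qed

text \<open>Level n of x is the class of 0. This makes products of coefficients vanish on the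
  filtration of the tensor product.\<close>

lemma coeff_completion_filt:
  assumes "x \<in> completion_filt G F n" "s \<in> S" "deg s \<le> n"
  shows "coeff x s = 0"
proof -
  have "x \<in> carrier (completion G F)" "x n = F n #>\<^bsub>G\<^esub> 0"
    using assms fg.coset_mult_one[of "F n"] subgroup.subset[OF fg.subgroup_filt[of n]]
    by (auto simp: completion_filt_def)
  from coeff_eq_lookup[OF this(1) _ this(2) assms(2,3)] show ?thesis by simp
qed

section \<open>Elements with prescribed coefficients\<close>

definition trunc :: "('s \<Rightarrow> int) \<Rightarrow> nat \<Rightarrow> 's \<Rightarrow>\<^sub>0 int" where
  "trunc c n = (\<Sum>s\<in>{s \<in> S. deg s \<le> n}. frag_cmul (c s) (frag_of s))"

lemma lookup_trunc: "Poly_Mapping.lookup (trunc c n) s = (if s \<in> S \<and> deg s \<le> n then c s else 0)"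
  using finite_deg[of n] by (simp add: trunc_def lookup_sum if_distrib sum.delta cong: if_cong)

lemma keys_trunc: "Poly_Mapping.keys (trunc c n) \<subseteq> S"
  by (auto simp: in_keys_iff lookup_trunc split: if_splits)

text \<open>The inverse of \<open>coeff\<close>: the formal sum of the multiples of s by
  \<open>c s\<close>, finite at each level by \<open>finite_deg\<close>.\<close>

definition series :: "('s \<Rightarrow> int) \<Rightarrow> nat \<Rightarrow> ('s \<Rightarrow>\<^sub>0 int) set" where
  "series c = (\<lambda>n. F n #>\<^bsub>G\<^esub> trunc c n)"

lemma series_closed: "series c \<in> carrier (completion G F)"
  unfolding fg.carrier_completion mem_Collect_eq
proof (intro conjI allI impI)
  show "series c n \<in> carrier (G Mod F n)" for n
    using keys_trunc by (auto simp: series_def carrier_FactGroup)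
  fix m n :: nat assume "m \<le> n"
  then have "F m #>\<^bsub>G\<^esub> trunc c n = F m #>\<^bsub>G\<^esub> trunc c m"
    by (subst rcos_eq_iff[OF keys_trunc keys_trunc]) (simp add: lookup_trunc)
  then show "F m <#>\<^bsub>G\<^esub> series c n = series c m"
    using fg.filt_set_mult_rcos[OF \<open>m \<le> n\<close>, of "trunc c n"] keys_trunc[of c n]
    by (simp add: series_def)
qed

lemma coeff_series: "s \<in> S \<Longrightarrow> coeff (series c) s = c s"
  using coeff_eq_lookup[OF series_closed keys_trunc, of c "deg s" c "deg s" s]
  by (simp add: series_def lookup_trunc)

text \<open>\<open>gfinprod\<close> multiplies only over the indices with nontrivial value, and at
  level n these are exactly the basis elements of degree at most n.\<close>

lemma completion_sum_eq_series:
  "completion_sum G F (\<lambda>s. to_completion G F (frag_of s)) S = series (\<lambda>_. 1)"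
proof
  fix n
  interpret Q: comm_group "G Mod F n" by (rule fg.comm_group_quotient)
  interpret h: group_hom G "G Mod F n" "\<lambda>g. F n #>\<^bsub>G\<^esub> g"
    by unfold_locales (rule normal.r_coset_hom_Mod[OF fg.normal_filt])
  let ?f = "\<lambda>s. F n #>\<^bsub>G\<^esub> frag_of s"
  have one: "F n #>\<^bsub>G\<^esub> 0 = F n" using h.hom_one by simp
  have "{s \<in> S. ?f s \<noteq> \<one>\<^bsub>G Mod F n\<^esub>} = {s \<in> S. deg s \<le> n}"
  proof -
    have "?f s = F n \<longleftrightarrow> \<not> deg s \<le> n" if "s \<in> S" for s
      using that rcos_eq_iff[of "frag_of s" 0 n] by (auto simp: one)
    then show ?thesis by auto
  qed
  moreover have "finprod (G Mod F n) ?f T = F n #>\<^bsub>G\<^esub> (\<Sum>s\<in>T. frag_of s)"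
    if "finite T" "T \<subseteq> S" for T
    using that
  proof induction
    case (insert t T)
    have "?f \<in> T \<rightarrow> carrier (G Mod F n)" "?f t \<in> carrier (G Mod F n)"
      using insert.prems by (auto simp: carrier_FactGroup)
    moreover have "(\<Sum>s\<in>T. frag_of s) \<in> carrier G"
      using insert.prems by (intro sum_closed_free_Abelian_group) auto
    ultimately show ?case
      using insert h.hom_mult[of "frag_of t" "\<Sum>s\<in>T. frag_of s"] by simp
  qed (simp add: one)
  ultimately show "completion_sum G F (\<lambda>s. to_completion G F (frag_of s)) S n = series (\<lambda>_. 1) n"
    using finite_deg[of n]
    by (simp add: completion_sum_def to_completion_def gfinprod_def series_def trunc_def)
qed

text \<open>Coefficients separate points, so additivity can be tested on one coefficient at a time.
  \<open>loc\<close> confines the coefficient at s to level \<open>deg s\<close>, which yields the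
  hypothesis \<open>dep\<close> of \<open>cont_linear_onI\<close>.\<close>

lemma series_cont_linear:
  assumes K: "filtered_group K E"
    and hom: "\<And>s. s \<in> S \<Longrightarrow> \<Lambda> s \<in> hom (completion K E) integer_group"
    and loc: "\<And>s x y. \<lbrakk>s \<in> S; x \<in> carrier (completion K E); y \<in> carrier (completion K E);
      x (deg s) = y (deg s)\<rbrakk> \<Longrightarrow> \<Lambda> s x = \<Lambda> s y"
  shows "(\<lambda>z\<in>carrier (completion K E). series (\<lambda>s. \<Lambda> s z)) \<in> cont_linear K E G F"
proof -
  interpret K: filtered_group K E by fact
  interpret CK: comm_group "completion K E" by (rule K.comm_group_completion)
  interpret C: comm_group "completion G F" by (rule fg.comm_group_completion)
  show ?thesis
  proof (rule K.cont_linear_onI)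
    show "filtered_group G F" by unfold_locales
    show "(\<lambda>z\<in>carrier (completion K E). series (\<lambda>s. \<Lambda> s z)) \<in> hom (completion K E) (completion G F)"
    proof (rule homI)
      fix x y assume xy: "x \<in> carrier (completion K E)" "y \<in> carrier (completion K E)"
      have "series (\<lambda>s. \<Lambda> s (x \<otimes>\<^bsub>completion K E\<^esub> y)) =
          series (\<lambda>s. \<Lambda> s x) \<otimes>\<^bsub>completion G F\<^esub> series (\<lambda>s. \<Lambda> s y)"
      proof (rule completion_eqI[OF series_closed C.m_closed[OF series_closed series_closed]])
        fix s assume s: "s \<in> S"
        show "coeff (series (\<lambda>s. \<Lambda> s (x \<otimes>\<^bsub>completion K E\<^esub> y))) s =
          coeff (series (\<lambda>s. \<Lambda> s x) \<otimes>\<^bsub>completion G F\<^esub> series (\<lambda>s. \<Lambda> s y)) s"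
          using hom_mult[OF hom[OF s] xy] s
          by (simp add: coeff_series coeff_mult series_closed)
      qed
      then show "(\<lambda>z\<in>carrier (completion K E). series (\<lambda>s. \<Lambda> s z)) (x \<otimes>\<^bsub>completion K E\<^esub> y) =
        (\<lambda>z\<in>carrier (completion K E). series (\<lambda>s. \<Lambda> s z)) x \<otimes>\<^bsub>completion G F\<^esub>
        (\<lambda>z\<in>carrier (completion K E). series (\<lambda>s. \<Lambda> s z)) y"
        using xy by simp
    qed (simp add: series_closed)
    fix x y n assume xy: "x \<in> carrier (completion K E)" "y \<in> carrier (completion K E)" "x n = y n"
    have "\<Lambda> s x = \<Lambda> s y" if "s \<in> S" "deg s \<le> n" for s
      using loc[OF that(1) xy(1,2) K.completion_eq_restrict[OF xy(1,2) that(2) xy(3)]] .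
    then have "trunc (\<lambda>s. \<Lambda> s x) n = trunc (\<lambda>s. \<Lambda> s y) n"
      unfolding trunc_def by (intro sum.cong) auto
    then show "(\<lambda>z\<in>carrier (completion K E). series (\<lambda>s. \<Lambda> s z)) x n =
      (\<lambda>z\<in>carrier (completion K E). series (\<lambda>s. \<Lambda> s z)) y n"
      using xy by (simp add: series_def)
  qed simp
qed

text \<open>The image of the free group lies in the subgroup generated by the basis elements, and it
  reaches every coset at every level.\<close>

lemma cont_linear_unique_frag:
  assumes K: "filtered_group K E"
    and f: "f \<in> cont_linear G F K E" and g: "g \<in> cont_linear G F K E"
    and eq: "\<And>s. s \<in> S \<Longrightarrow> f (to_completion G F (frag_of s)) = g (to_completion G F (frag_of s))"
  shows "f = g"
proof -
  interpret C: comm_group "completion G F" by (rule fg.comm_group_completion)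
  let ?D = "(\<lambda>s. to_completion G F (frag_of s)) ` S"
  have D: "?D \<subseteq> carrier (completion G F)"
    using fg.to_completion_closed by auto
  show ?thesis
  proof (rule fg.cont_linear_unique[OF K f g D])
    show "f d = g d" if "d \<in> ?D" for d using that eq by auto
    fix t n assume "t \<in> carrier G"
    then have "to_completion G F t \<in> generate (completion G F) ?D"
      using hom_free_Abelian_group_in_subgroup[OF fg.to_completion_hom C.is_group
          C.generate_is_subgroup[OF D]]
      by (auto intro: generate.incl)
    then show "\<exists>d\<in>generate (completion G F) ?D. d n = F n #>\<^bsub>G\<^esub> t"
      by (rule rev_bexI) (simp add: to_completion_def)
  qed
qed

end

section \<open>Tensor products\<close>

locale tensor_pair = G: comm_group G + H: comm_group H
  for G :: "('a, 'm) monoid_scheme" and H :: "('b, 'l) monoid_scheme"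
begin

abbreviation "Pairs \<equiv> free_Abelian_group (carrier G \<times> carrier H)"
abbreviation "T \<equiv> tensor G H"
abbreviation "pure \<equiv> pure_tensor G H"

lemma keys_frag_diff3:
  assumes "p \<in> X" "q \<in> X" "r \<in> X"
  shows "Poly_Mapping.keys (frag_of p - frag_of q - frag_of r) \<subseteq> X"
  using keys_diff[of "frag_of p - frag_of q" "frag_of r"] keys_diff[of "frag_of p" "frag_of q"] assms
  by auto

lemma subgroup_tensor_relations: "subgroup (tensor_relations G H) Pairs"
  unfolding tensor_relations_def
proof (rule group.generate_is_subgroup[OF group_free_Abelian_group], intro Un_least subsetI;
    elim CollectE exE conjE; hypsubst)
  fix x x' y assume "x \<in> carrier G" "x' \<in> carrier G" "y \<in> carrier H"
  then show "frag_of (x \<otimes>\<^bsub>G\<^esub> x', y) - frag_of (x, y) - frag_of (x', y) \<in> carrier Pairs"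
    unfolding carrier_free_Abelian_group_iff by (intro keys_frag_diff3) simp_all
next
  fix x y y' assume "x \<in> carrier G" "y \<in> carrier H" "y' \<in> carrier H"
  then show "frag_of (x, y \<otimes>\<^bsub>H\<^esub> y') - frag_of (x, y) - frag_of (x, y') \<in> carrier Pairs"
    unfolding carrier_free_Abelian_group_iff by (intro keys_frag_diff3) simp_all
qed

sublocale T: comm_group T
  unfolding tensor_def
  by (rule comm_group.abelian_FactGroup[OF abelian_free_Abelian_group subgroup_tensor_relations])

lemma proj_tensor: "(\<lambda>g. tensor_relations G H #>\<^bsub>Pairs\<^esub> g) \<in> hom Pairs T"
  unfolding tensor_def
  by (rule normal.r_coset_hom_Mod[OF comm_group.subgroup_imp_normal[OF abelian_free_Abelian_group
          subgroup_tensor_relations]])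

sublocale proj: group_hom Pairs T "\<lambda>g. tensor_relations G H #>\<^bsub>Pairs\<^esub> g"
  by (intro group_hom.intro group_hom_axioms.intro group_free_Abelian_group T.is_group proj_tensor)

lemma proj_tensor_relation:
  assumes "g \<in> tensor_relations G H"
  shows "tensor_relations G H #>\<^bsub>Pairs\<^esub> g = \<one>\<^bsub>T\<^esub>"
  using subgroup.rcos_const[OF subgroup_tensor_relations _ assms] by (simp add: tensor_def)

lemma pure_closed: "\<lbrakk>x \<in> carrier G; y \<in> carrier H\<rbrakk> \<Longrightarrow> pure x y \<in> carrier T"
  unfolding pure_tensor_def by (rule proj.hom_closed) simp

text \<open>In the free group the pair for the product differs from the sum of the other two pairs
  by a defining relation, which the projection kills.\<close>

lemma pure_mult_left:
  assumes "x \<in> carrier G" "x' \<in> carrier G" "y \<in> carrier H"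
  shows "pure (x \<otimes>\<^bsub>G\<^esub> x') y = pure x y \<otimes>\<^bsub>T\<^esub> pure x' y"
proof -
  let ?r = "frag_of (x \<otimes>\<^bsub>G\<^esub> x', y) - frag_of (x, y) - frag_of (x', y)"
  have "?r \<in> tensor_relations G H"
    unfolding tensor_relations_def using assms by (intro generate.incl) blast
  then have r: "tensor_relations G H #>\<^bsub>Pairs\<^esub> ?r = \<one>\<^bsub>T\<^esub>" by (rule proj_tensor_relation)
  have c: "?r \<in> carrier Pairs" "frag_of (x, y) \<in> carrier Pairs" "frag_of (x', y) \<in> carrier Pairs"
    using keys_frag_diff3[of "(x \<otimes>\<^bsub>G\<^esub> x', y)" "carrier G \<times> carrier H" "(x, y)" "(x', y)"] assms by auto
  have "pure (x \<otimes>\<^bsub>G\<^esub> x') y = tensor_relations G H #>\<^bsub>Pairs\<^esub>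
      (?r \<otimes>\<^bsub>Pairs\<^esub> (frag_of (x, y) \<otimes>\<^bsub>Pairs\<^esub> frag_of (x', y)))"
    by (simp add: pure_tensor_def)
  also have "\<dots> = pure x y \<otimes>\<^bsub>T\<^esub> pure x' y"
    unfolding pure_tensor_def
    using c proj.hom_mult proj.hom_closed r by (metis T.l_one T.m_closed monoid.m_closed proj.G.is_monoid)
  finally show ?thesis .
qed

lemma pure_mult_right:
  assumes "x \<in> carrier G" "y \<in> carrier H" "y' \<in> carrier H"
  shows "pure x (y \<otimes>\<^bsub>H\<^esub> y') = pure x y \<otimes>\<^bsub>T\<^esub> pure x y'"
proof -
  let ?r = "frag_of (x, y \<otimes>\<^bsub>H\<^esub> y') - frag_of (x, y) - frag_of (x, y')"
  have "?r \<in> tensor_relations G H"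
    unfolding tensor_relations_def using assms by (intro generate.incl) blast
  then have r: "tensor_relations G H #>\<^bsub>Pairs\<^esub> ?r = \<one>\<^bsub>T\<^esub>" by (rule proj_tensor_relation)
  have c: "?r \<in> carrier Pairs" "frag_of (x, y) \<in> carrier Pairs" "frag_of (x, y') \<in> carrier Pairs"
    using keys_frag_diff3[of "(x, y \<otimes>\<^bsub>H\<^esub> y')" "carrier G \<times> carrier H" "(x, y)" "(x, y')"] assms by auto
  have "pure x (y \<otimes>\<^bsub>H\<^esub> y') = tensor_relations G H #>\<^bsub>Pairs\<^esub>
      (?r \<otimes>\<^bsub>Pairs\<^esub> (frag_of (x, y) \<otimes>\<^bsub>Pairs\<^esub> frag_of (x, y')))"
    by (simp add: pure_tensor_def)
  also have "\<dots> = pure x y \<otimes>\<^bsub>T\<^esub> pure x y'"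
    unfolding pure_tensor_def
    using c proj.hom_mult proj.hom_closed r by (metis T.l_one T.m_closed monoid.m_closed proj.G.is_monoid)
  finally show ?thesis .
qed

lemma pure_hom_left: "y \<in> carrier H \<Longrightarrow> (\<lambda>x. pure x y) \<in> hom G T"
  by (rule homI) (auto simp: pure_closed pure_mult_left)

lemma pure_hom_right: "x \<in> carrier G \<Longrightarrow> (\<lambda>y. pure x y) \<in> hom H T"
  by (rule homI) (auto simp: pure_closed pure_mult_right)

text \<open>The class of a pair is a pure tensor, so pure tensors generate. This serves as induction
  on tensors.\<close>

lemma tensor_subgroup_eqI:
  assumes K: "subgroup K T" and pure: "\<And>x y. \<lbrakk>x \<in> carrier G; y \<in> carrier H\<rbrakk> \<Longrightarrow> pure x y \<in> K"
  shows "carrier T \<subseteq> K"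
proof
  fix t assume "t \<in> carrier T"
  then obtain g where g: "Poly_Mapping.keys g \<subseteq> carrier G \<times> carrier H"
    "t = tensor_relations G H #>\<^bsub>Pairs\<^esub> g"
    by (auto simp: tensor_def carrier_FactGroup)
  have "tensor_relations G H #>\<^bsub>Pairs\<^esub> g \<in> K"
    by (rule hom_free_Abelian_group_in_subgroup[OF proj_tensor T.is_group K _ g(1)])
      (use pure in \<open>auto simp: pure_tensor_def\<close>)
  then show "t \<in> K" using g(2) by simp
qed

text \<open>Extend b freely to combinations of pairs. Bilinearity places the relations in the
  kernel, so the extension factors through the quotient.\<close>

lemma tensor_universal:
  assumes K: "comm_group K"
    and left: "\<And>x x' y. \<lbrakk>x \<in> carrier G; x' \<in> carrier G; y \<in> carrier H\<rbrakk> \<Longrightarrow>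
      b (x \<otimes>\<^bsub>G\<^esub> x') y = b x y \<otimes>\<^bsub>K\<^esub> b x' y"
    and right: "\<And>x y y'. \<lbrakk>x \<in> carrier G; y \<in> carrier H; y' \<in> carrier H\<rbrakk> \<Longrightarrow>
      b x (y \<otimes>\<^bsub>H\<^esub> y') = b x y \<otimes>\<^bsub>K\<^esub> b x y'"
    and closed: "\<And>x y. \<lbrakk>x \<in> carrier G; y \<in> carrier H\<rbrakk> \<Longrightarrow> b x y \<in> carrier K"
  obtains h where "h \<in> hom T K"
    "\<And>x y. \<lbrakk>x \<in> carrier G; y \<in> carrier H\<rbrakk> \<Longrightarrow> h (pure x y) = b x y"
proof -
  interpret K: comm_group K by fact
  have "(\<lambda>(x, y). b x y) ` (carrier G \<times> carrier H) \<subseteq> carrier K" using closed by auto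
  from K.free_Abelian_group_universal[OF this]
  obtain f where f: "f \<in> hom Pairs K"
    "\<And>p. p \<in> carrier G \<times> carrier H \<Longrightarrow> f (frag_of p) = (\<lambda>(x, y). b x y) p"
    by blast
  interpret f: group_hom Pairs K f
    by (intro group_hom.intro group_hom_axioms.intro group_free_Abelian_group K.is_group f(1))
  have diff: "f (u - v) = f u \<otimes>\<^bsub>K\<^esub> inv\<^bsub>K\<^esub> f v"
    if "Poly_Mapping.keys u \<subseteq> carrier G \<times> carrier H" "Poly_Mapping.keys v \<subseteq> carrier G \<times> carrier H" for u v
    using that f.hom_mult[of u "inv\<^bsub>Pairs\<^esub> v"] f.hom_inv[of v] by simp
  \<comment> \<open>Both kinds of bilinearity relation have this three-term shape, so one
    computation covers them.\<close>
  have diff3: "f (frag_of p - frag_of q - frag_of r) = \<one>\<^bsub>K\<^esub>"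
    if "p \<in> carrier G \<times> carrier H" "q \<in> carrier G \<times> carrier H" "r \<in> carrier G \<times> carrier H"
      "f (frag_of p) = f (frag_of q) \<otimes>\<^bsub>K\<^esub> f (frag_of r)" for p q r
  proof -
    have c: "f (frag_of q) \<in> carrier K" "f (frag_of r) \<in> carrier K" using that by simp_all
    have "Poly_Mapping.keys (frag_of p - frag_of q) \<subseteq> carrier G \<times> carrier H"
      using that keys_diff[of "frag_of p" "frag_of q"] by auto
    then have "f (frag_of p - frag_of q - frag_of r) =
        f (frag_of q) \<otimes>\<^bsub>K\<^esub> f (frag_of r) \<otimes>\<^bsub>K\<^esub> inv\<^bsub>K\<^esub> f (frag_of q) \<otimes>\<^bsub>K\<^esub> inv\<^bsub>K\<^esub> f (frag_of r)"
      using that by (simp add: diff)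
    also have "\<dots> = f (frag_of q) \<otimes>\<^bsub>K\<^esub> f (frag_of r) \<otimes>\<^bsub>K\<^esub> inv\<^bsub>K\<^esub> (f (frag_of q) \<otimes>\<^bsub>K\<^esub> f (frag_of r))"
      using c by (simp add: K.m_assoc K.inv_mult)
    finally show ?thesis using c by simp
  qed
  have ker: "tensor_relations G H \<subseteq> kernel Pairs K f"
    unfolding tensor_relations_def
  proof (rule group.generate_subgroup_incl[OF group_free_Abelian_group _ f.subgroup_kernel], intro subsetI)
    fix g assume "g \<in> {frag_of (x \<otimes>\<^bsub>G\<^esub> x', y) - frag_of (x, y) - frag_of (x', y) | x x' y.
          x \<in> carrier G \<and> x' \<in> carrier G \<and> y \<in> carrier H} \<union>
       {frag_of (x, y \<otimes>\<^bsub>H\<^esub> y') - frag_of (x, y) - frag_of (x, y') | x y y'.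
          x \<in> carrier G \<and> y \<in> carrier H \<and> y' \<in> carrier H}"
    then obtain p q r where pqr: "g = frag_of p - frag_of q - frag_of r"
      "p \<in> carrier G \<times> carrier H" "q \<in> carrier G \<times> carrier H" "r \<in> carrier G \<times> carrier H"
      "f (frag_of p) = f (frag_of q) \<otimes>\<^bsub>K\<^esub> f (frag_of r)"
    proof (elim UnE CollectE exE conjE, goal_cases)
      case (1 x x' y)
      show ?case by (rule 1(1)[OF 1(2)]) (use 1 left in \<open>auto simp: f\<close>)
    next
      case (2 x y y')
      show ?case by (rule 2(1)[OF 2(2)]) (use 2 right in \<open>auto simp: f\<close>)
    qed
    then show "g \<in> kernel Pairs K f"
      using diff3[OF pqr(2-5)] keys_frag_diff3[OF pqr(2-4)] by (simp add: kernel_def)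
  qed
  from f.FactGroup_universal_kernel[OF comm_group.subgroup_imp_normal[OF abelian_free_Abelian_group
        subgroup_tensor_relations] ker]
  obtain h where h: "h \<in> hom T K"
    "\<And>g. g \<in> carrier Pairs \<Longrightarrow> h (tensor_relations G H #>\<^bsub>Pairs\<^esub> g) = f g"
    unfolding tensor_def by blast
  show thesis
  proof (rule that[OF h(1)])
    fix x y assume "x \<in> carrier G" "y \<in> carrier H"
    then show "h (pure x y) = b x y" by (simp add: pure_tensor_def h f)
  qed
qed

lemma tensor_filt_gens:
  assumes "filtered_group G F" "filtered_group H E"
  shows "{pure x y | x y. x \<in> F n \<and> y \<in> carrier H} \<union> {pure x y | x y. x \<in> carrier G \<and> y \<in> E n} \<subseteq> carrier T"
  using assms[THEN filtered_group.subgroup_filt, THEN subgroup.subset, of n] pure_closed by blast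

lemma filtered_tensor:
  assumes "filtered_group G F" "filtered_group H E"
  shows "filtered_group T (tensor_filt G F H E)"
proof (intro filtered_group.intro filtered_group_axioms.intro T.comm_group_axioms)
  show "subgroup (tensor_filt G F H E n) T" for n
    unfolding tensor_filt_def by (rule T.generate_is_subgroup[OF tensor_filt_gens[OF assms]])
  show "tensor_filt G F H E n \<subseteq> tensor_filt G F H E m" if "m \<le> n" for m n
    unfolding tensor_filt_def
    by (rule T.mono_generate)
      (use filtered_group.filt_antimono[OF assms(1) that] filtered_group.filt_antimono[OF assms(2) that] in blast)
qed

end

section \<open>The completed tensor product of two graded completions\<close>

locale graded_pair = A: graded_free_group S1 d1 F1 + B: graded_free_group S2 d2 F2
  for S1 :: "'s set" and d1 F1 and S2 :: "'t set" and d2 F2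
begin

abbreviation "CA \<equiv> completion A.G F1"
abbreviation "CB \<equiv> completion B.G F2"
abbreviation "Tf \<equiv> tensor_filt CA (completion_filt A.G F1) CB (completion_filt B.G F2)"
abbreviation "CT \<equiv> completion (tensor CA CB) Tf"
abbreviation "inA \<equiv> to_completion A.G F1"
abbreviation "inB \<equiv> to_completion B.G F2"
abbreviation "ctens x y \<equiv> to_completion (tensor CA CB) Tf (pure_tensor CA CB x y)"

sublocale tp: tensor_pair CA CB
  using A.fg.comm_group_completion B.fg.comm_group_completion by (rule tensor_pair.intro)

sublocale ft: filtered_group "tensor CA CB" Tf
  by (rule tp.filtered_tensor[OF A.fg.filtered_completion B.fg.filtered_completion])

lemma ctens_closed: "\<lbrakk>x \<in> carrier CA; y \<in> carrier CB\<rbrakk> \<Longrightarrow> ctens x y \<in> carrier CT"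
  by (intro ft.to_completion_closed tp.pure_closed)

text \<open>The product of two coefficients is bilinear, so it defines a homomorphism on tensors.
  Since a and b have degree at most n, one factor vanishes on each generator of \<open>Tf n\<close>;
  the homomorphism therefore passes to level n, and composing with the projection to that level
  gives a functional on the completion that sees nothing else.\<close>

lemma ex_coeff_functional:
  assumes a: "a \<in> S1" "d1 a \<le> n" and b: "b \<in> S2" "d2 b \<le> n"
  shows "\<exists>\<Lambda> \<in> hom CT integer_group.
    (\<forall>x\<in>carrier CA. \<forall>y\<in>carrier CB. \<Lambda> (ctens x y) = A.coeff x a * B.coeff y b) \<and>
    (\<forall>z z'. z n = z' n \<longrightarrow> \<Lambda> z = \<Lambda> z')"
proof -
  interpret Z: comm_group integer_group by (rule abelian_integer_group)
  obtain h where h: "h \<in> hom (tensor CA CB) integer_group"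
    "\<And>x y. \<lbrakk>x \<in> carrier CA; y \<in> carrier CB\<rbrakk> \<Longrightarrow> h (pure_tensor CA CB x y) = A.coeff x a * B.coeff y b"
  proof (rule tp.tensor_universal[OF abelian_integer_group, of "\<lambda>x y. A.coeff x a * B.coeff y b"])
  qed (use a b in \<open>auto simp: A.coeff_mult B.coeff_mult algebra_simps\<close>)
  interpret h: group_hom "tensor CA CB" integer_group h
    by (intro group_hom.intro group_hom_axioms.intro tp.T.is_group Z.is_group h(1))
  have "Tf n \<subseteq> kernel (tensor CA CB) integer_group h"
    unfolding tensor_filt_def
  proof (rule tp.T.generate_subgroup_incl[OF _ h.subgroup_kernel], intro Un_least subsetI; elim CollectE exE conjE; hypsubst)
    fix x y assume xy: "x \<in> completion_filt A.G F1 n" "y \<in> carrier CB"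
    then have "x \<in> carrier CA" by (simp add: completion_filt_def)
    then show "pure_tensor CA CB x y \<in> kernel (tensor CA CB) integer_group h"
      using xy A.coeff_completion_filt[OF xy(1) a] by (simp add: kernel_def h(2) tp.pure_closed)
  next
    fix x y assume xy: "x \<in> carrier CA" "y \<in> completion_filt B.G F2 n"
    then have "y \<in> carrier CB" by (simp add: completion_filt_def)
    then show "pure_tensor CA CB x y \<in> kernel (tensor CA CB) integer_group h"
      using xy B.coeff_completion_filt[OF xy(2) b] by (simp add: kernel_def h(2) tp.pure_closed)
  qed
  from h.FactGroup_universal_kernel[OF ft.normal_filt this]
  obtain g where g: "g \<in> hom (tensor CA CB Mod Tf n) integer_group"
    "\<And>t. t \<in> carrier (tensor CA CB) \<Longrightarrow> g (Tf n #>\<^bsub>tensor CA CB\<^esub> t) = h t" by blast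
  have "g \<circ> (\<lambda>z. z n) \<in> hom CT integer_group"
    by (rule hom_compose[OF ft.proj_completion_hom g(1)])
  moreover have "(g \<circ> (\<lambda>z. z n)) (ctens x y) = A.coeff x a * B.coeff y b"
    if "x \<in> carrier CA" "y \<in> carrier CB" for x y
    using that g(2)[OF tp.pure_closed] h(2) by (simp add: to_completion_def)
  ultimately show ?thesis by (intro bexI[of _ "g \<circ> (\<lambda>z. z n)"]) auto
qed

text \<open>Change one factor at a time, passing through the tensor of x' and y: each difference is
  a pure tensor with a factor in the kernel of level n.\<close>

lemma rcos_pure_cong:
  assumes x: "x \<in> carrier CA" "x' \<in> carrier CA" "x n = x' n"
    and y: "y \<in> carrier CB" "y' \<in> carrier CB" "y n = y' n"
  shows "Tf n #>\<^bsub>tensor CA CB\<^esub> pure_tensor CA CB x y = Tf n #>\<^bsub>tensor CA CB\<^esub> pure_tensor CA CB x' y'"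
proof -
  let ?T = "tensor CA CB" and ?p = "pure_tensor CA CB"
  interpret pA: group_hom CA "A.G Mod F1 n" "\<lambda>x. x n"
    by (intro group_hom.intro group_hom_axioms.intro tp.G.is_group A.fg.proj_completion_hom
        comm_group.axioms(2)[OF A.fg.comm_group_quotient])
  interpret pB: group_hom CB "B.G Mod F2 n" "\<lambda>x. x n"
    by (intro group_hom.intro group_hom_axioms.intro tp.H.is_group B.fg.proj_completion_hom
        comm_group.axioms(2)[OF B.fg.comm_group_quotient])
  interpret l: group_hom CA ?T "\<lambda>x. ?p x y"
    by (intro group_hom.intro group_hom_axioms.intro tp.G.is_group tp.T.is_group tp.pure_hom_left y)
  interpret r: group_hom CB ?T "\<lambda>y. ?p x' y"
    by (intro group_hom.intro group_hom_axioms.intro tp.H.is_group tp.T.is_group tp.pure_hom_right x)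
  let ?u = "x \<otimes>\<^bsub>CA\<^esub> inv\<^bsub>CA\<^esub> x'" and ?v = "y \<otimes>\<^bsub>CB\<^esub> inv\<^bsub>CB\<^esub> y'"
  have u: "?u \<in> carrier CA" "?u n = \<one>\<^bsub>A.G Mod F1 n\<^esub>"
    using x pA.H.r_inv[OF pA.hom_closed[OF x(2)]] pA.hom_mult[OF x(1) tp.G.inv_closed[OF x(2)]]
      pA.hom_inv[OF x(2)] by simp_all
  have v: "?v \<in> carrier CB" "?v n = \<one>\<^bsub>B.G Mod F2 n\<^esub>"
    using y pB.H.r_inv[OF pB.hom_closed[OF y(2)]] pB.hom_mult[OF y(1) tp.H.inv_closed[OF y(2)]]
      pB.hom_inv[OF y(2)] by simp_all
  have "?u \<in> completion_filt A.G F1 n" "?v \<in> completion_filt B.G F2 n"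
    using u v by (auto simp: completion_filt_def)
  then have "?p ?u y \<in> Tf n" "?p x' ?v \<in> Tf n"
    unfolding tensor_filt_def using x y by (auto intro!: generate.incl)
  moreover have "?p ?u y = ?p x y \<otimes>\<^bsub>?T\<^esub> inv\<^bsub>?T\<^esub> ?p x' y"
    using x y l.hom_mult[OF x(1) tp.G.inv_closed[OF x(2)]] l.hom_inv[OF x(2)] by simp
  moreover have "?p x' ?v = ?p x' y \<otimes>\<^bsub>?T\<^esub> inv\<^bsub>?T\<^esub> ?p x' y'"
    using x y r.hom_mult[OF y(1) tp.H.inv_closed[OF y(2)]] r.hom_inv[OF y(2)] by simp
  ultimately show ?thesis
    using ft.rcos_filt_eq_iff[of "?p x y" "?p x' y" n] ft.rcos_filt_eq_iff[of "?p x' y" "?p x' y'" n]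
      x y tp.pure_closed by simp
qed

text \<open>In the application these are the tensors of symbols, where \<open>times1\<close> is
  prescribed.\<close>

definition pure_gens :: "(nat \<Rightarrow> ((nat \<Rightarrow> ('s \<Rightarrow>\<^sub>0 int) set) \<times> (nat \<Rightarrow> ('t \<Rightarrow>\<^sub>0 int) set) \<Rightarrow>\<^sub>0 int) set set) set" where
  "pure_gens = {ctens (inA (frag_of s)) (inB (frag_of t)) | s t. s \<in> S1 \<and> t \<in> S2}"

lemma pure_gens_subset: "pure_gens \<subseteq> carrier CT"
proof -
  have "inA (frag_of s) \<in> carrier CA" "inB (frag_of t) \<in> carrier CB" if "s \<in> S1" "t \<in> S2" for s t
    using that A.fg.to_completion_closed[of "frag_of s"] B.fg.to_completion_closed[of "frag_of t"] by simp_all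
  then show ?thesis unfolding pure_gens_def using ctens_closed by blast
qed

text \<open>A factor taken from a completion may be an infinite series, but modulo
  \<open>Tf n\<close> it can be replaced by a finite combination with the same level n. Bilinearity
  then reduces to basis elements.\<close>

lemma pure_gens_dense:
  assumes "t \<in> carrier (tensor CA CB)"
  shows "\<exists>d\<in>generate CT pure_gens. d n = Tf n #>\<^bsub>tensor CA CB\<^esub> t"
proof -
  let ?T = "tensor CA CB" and ?p = "pure_tensor CA CB"
  interpret CT: comm_group CT by (rule ft.comm_group_completion)
  interpret q: group_hom ?T CT "to_completion ?T Tf"
    by (intro group_hom.intro group_hom_axioms.intro tp.T.is_group CT.is_group ft.to_completion_hom)
  have sD: "subgroup (generate CT pure_gens) CT" by (rule CT.generate_is_subgroup[OF pure_gens_subset])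
  \<comment> \<open>The tensors that can be approximated at level n. Being the preimage of a
    subgroup under a homomorphism, P is a subgroup, so it is enough to treat pure tensors.\<close>
  define P where "P = {t \<in> carrier ?T. \<exists>d\<in>generate CT pure_gens. d n = Tf n #>\<^bsub>?T\<^esub> t}"
  interpret pn: group_hom CT "?T Mod Tf n" "\<lambda>z. z n"
    by (intro group_hom.intro group_hom_axioms.intro CT.is_group ft.proj_completion_hom
        comm_group.axioms(2)[OF ft.comm_group_quotient])
  interpret rn: group_hom ?T "?T Mod Tf n" "\<lambda>t. Tf n #>\<^bsub>?T\<^esub> t"
    by (intro group_hom.intro group_hom_axioms.intro tp.T.is_group normal.r_coset_hom_Mod ft.normal_filt
        comm_group.axioms(2)[OF ft.comm_group_quotient])
  have "P = {t \<in> carrier ?T. Tf n #>\<^bsub>?T\<^esub> t \<in> (\<lambda>z. z n) ` generate CT pure_gens}"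
    by (simp add: P_def image_iff eq_commute)
  moreover have "subgroup ((\<lambda>z. z n) ` generate CT pure_gens) (?T Mod Tf n)"
    by (rule pn.subgroup_img_is_subgroup[OF sD])
  ultimately have sP: "subgroup P ?T"
    using rn.subgroup_vimage by simp
  have frag: "?p (inA g) (inB h) \<in> P" if g: "Poly_Mapping.keys g \<subseteq> S1" and h: "Poly_Mapping.keys h \<subseteq> S2" for g h
  proof -
    have inA: "inA g' \<in> carrier CA" if "Poly_Mapping.keys g' \<subseteq> S1" for g'
      using that by (intro A.fg.to_completion_closed) simp
    have inB: "inB h' \<in> carrier CB" if "Poly_Mapping.keys h' \<subseteq> S2" for h'
      using that by (intro B.fg.to_completion_closed) simp
    have 1: "?p (inA (frag_of s)) (inB (frag_of t)) \<in> P" if "s \<in> S1" "t \<in> S2" for s t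
    proof -
      have "ctens (inA (frag_of s)) (inB (frag_of t)) \<in> generate CT pure_gens"
        using that by (intro generate.incl) (auto simp: pure_gens_def)
      then show ?thesis
        using that tp.pure_closed[OF inA[of "frag_of s"] inB[of "frag_of t"]]
        by (auto simp: P_def to_completion_def)
    qed
    \<comment> \<open>Additivity is used in one factor at a time: here in the right one, with a
      basis element on the left, and afterwards in the left one.\<close>
    have 2: "?p (inA (frag_of s)) (inB h) \<in> P" if "s \<in> S1" for s
    proof -
      have "((\<lambda>y. ?p (inA (frag_of s)) y) \<circ> inB) h \<in> P"
        by (rule hom_free_Abelian_group_in_subgroup[OF hom_compose[OF B.fg.to_completion_hom
                tp.pure_hom_right] tp.T.is_group sP _ h])
          (use 1 that inA[of "frag_of s"] in auto)
      then show ?thesis by simp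
    qed
    have "((\<lambda>x. ?p x (inB h)) \<circ> inA) g \<in> P"
      by (rule hom_free_Abelian_group_in_subgroup[OF hom_compose[OF A.fg.to_completion_hom
              tp.pure_hom_left] tp.T.is_group sP _ g])
        (use 2 inB[OF h] in auto)
    then show ?thesis by simp
  qed
  have "carrier ?T \<subseteq> P"
  proof (rule tp.tensor_subgroup_eqI[OF sP])
    fix x y assume x: "x \<in> carrier CA" and y: "y \<in> carrier CB"
    obtain g where g: "Poly_Mapping.keys g \<subseteq> S1" "x n = F1 n #>\<^bsub>A.G\<^esub> g" by (rule A.completion_repr[OF x])
    obtain h where h: "Poly_Mapping.keys h \<subseteq> S2" "y n = F2 n #>\<^bsub>B.G\<^esub> h" by (rule B.completion_repr[OF y])
    have "inA g \<in> carrier CA" "inB h \<in> carrier CB"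
      using g h A.fg.to_completion_closed[of g] B.fg.to_completion_closed[of h] by simp_all
    then have "Tf n #>\<^bsub>?T\<^esub> ?p x y = Tf n #>\<^bsub>?T\<^esub> ?p (inA g) (inB h)"
      using x y g h by (intro rcos_pure_cong) (simp_all add: to_completion_def)
    then show "?p x y \<in> P" using frag[OF g(1) h(1)] tp.pure_closed[OF x y] by (simp add: P_def)
  qed
  then show ?thesis using assms by (auto simp: P_def)
qed

end

section \<open>Shuffles and classes of triples\<close>

text \<open>In a list without repetitions a subsequence is determined by the set of its
  entries.\<close>

lemma subseq_distinct_iff_filter:
  assumes "distinct ys"
  shows "subseq xs ys \<longleftrightarrow> xs = filter (\<lambda>x. x \<in> set xs) ys"
proof
  assume s: "subseq xs ys"
  let ?P = "\<lambda>x. x \<in> set xs"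
  have "filter ?P xs = xs" by (simp add: filter_id_conv)
  then have sub: "subseq xs (filter ?P ys)" using subseq_filter[OF s, of ?P] by simp
  have "set (filter ?P ys) = set xs"
    using s by (auto dest: subseq_order.trans list_emb_set)
  moreover have "distinct (filter ?P ys)" using assms by simp
  ultimately have "length (filter ?P ys) \<le> length xs"
    by (metis card_length distinct_card)
  moreover have "length xs \<le> length (filter ?P ys)" using sub by (rule list_emb_length)
  ultimately show "xs = filter ?P ys" using subseq_same_length[OF sub] by simp
next
  assume "xs = filter (\<lambda>x. x \<in> set xs) ys"
  then show "subseq xs ys" by (metis subseq_filter_left)
qed

lemma permutes_eqI_map:
  assumes "\<sigma> permutes {1..n}" "\<sigma>' permutes {1..n}" "map \<sigma> [1..<Suc n] = map \<sigma>' [1..<Suc n]"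
  shows "\<sigma> = \<sigma>'"
proof
  fix x show "\<sigma> x = \<sigma>' x"
  proof (cases "x \<in> {1..n}")
    case True
    then show ?thesis using assms(3) by (auto simp: map_eq_conv simp del: upt_Suc)
  next
    case False
    then show ?thesis using assms(1,2) by (simp add: permutes_not_in)
  qed
qed

lemma ex_permutes_map:
  assumes "distinct xs" "set xs = {1..n::nat}"
  shows "\<exists>\<sigma>. \<sigma> permutes {1..n} \<and> map \<sigma> [1..<Suc n] = xs"
proof -
  \<comment> \<open>Lists are indexed from 0 and permutations from 1; outside the range
    \<open>permutes\<close> requires the identity.\<close>
  define \<sigma> where "\<sigma> i = (if i \<in> {1..n} then xs ! (i - 1) else i)" for i
  have len: "length xs = n" using assms distinct_card[OF assms(1)] by simp
  have map: "map \<sigma> [1..<Suc n] = xs"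
    by (rule nth_equalityI) (auto simp: len \<sigma>_def simp del: upt_Suc)
  have "set (map \<sigma> [1..<Suc n]) = {1..n}" "distinct (map \<sigma> [1..<Suc n])" using map assms by simp_all
  moreover have "set [1..<Suc n] = {1..n}" by auto
  ultimately have "bij_betw \<sigma> {1..n} {1..n}"
    unfolding distinct_map bij_betw_def by (metis set_map)
  moreover have "\<sigma> i = i" if "i \<notin> {1..n}" for i using that by (auto simp: \<sigma>_def)
  ultimately show ?thesis using map bij_imp_permutes by blast
qed

lemma permutes_map_upt:
  assumes "\<sigma> permutes {1..n}"
  shows "distinct (map \<sigma> [1..<Suc n])" "set (map \<sigma> [1..<Suc n]) = {1..n}"
proof -
  have "set [1..<Suc n] = {1..n}" by auto
  then show "distinct (map \<sigma> [1..<Suc n])" "set (map \<sigma> [1..<Suc n]) = {1..n}"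
    using permutes_image[OF assms] permutes_inj_on[OF assms]
    by (simp_all add: distinct_map del: upt_Suc)
qed

lemma map_shift_perm:
  "map (shift_perm m \<tau>) [Suc m..<Suc (m + n)] = map (\<lambda>x. m + x) (map \<tau> [1..<Suc n])"
  by (rule nth_equalityI) (auto simp: shift_perm_def simp del: upt_Suc)

text \<open>The values of \<sigma> fill {1..m} and the shifted values of \<tau> fill {m+1..m+n}, so
  the two subsequence conditions say that \<sigma> and \<tau> are read off \<rho> by keeping its
  small and its large values. In this form the shuffle can be solved for \<sigma> and
  \<tau>.\<close>

lemma shuffle_perms_iff:
  assumes \<sigma>: "\<sigma> permutes {1..m}" and \<tau>: "\<tau> permutes {1..n}"
  shows "\<rho> \<in> shuffle_perms m n \<sigma> (shift_perm m \<tau>) \<longleftrightarrow> \<rho> permutes {1..m+n} \<and>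
    map \<sigma> [1..<Suc m] = filter (\<lambda>x. x \<le> m) (map \<rho> [1..<Suc (m+n)]) \<and>
    map (\<lambda>x. m + x) (map \<tau> [1..<Suc n]) = filter (\<lambda>x. m < x) (map \<rho> [1..<Suc (m+n)])"
proof (cases "\<rho> permutes {1..m+n}")
  case True
  let ?L = "map \<rho> [1..<Suc (m+n)]"
  note L = permutes_map_upt[OF True]
  have "filter (\<lambda>x. x \<in> set (map \<sigma> [1..<Suc m])) ?L = filter (\<lambda>x. x \<le> m) ?L"
    unfolding permutes_map_upt(2)[OF \<sigma>] using L(2) by (intro filter_cong) auto
  moreover have "filter (\<lambda>x. x \<in> set (map (\<lambda>x. m + x) (map \<tau> [1..<Suc n]))) ?L = filter (\<lambda>x. m < x) ?L"
  proof (intro filter_cong refl)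
    fix x assume "x \<in> set ?L"
    then have "x \<in> {1..m+n}" using L(2) by blast
    then have "x \<in> (\<lambda>x. m + x) ` {1..n} \<longleftrightarrow> m < x"
      by (auto simp: image_iff intro: bexI[of _ "x - m"])
    then show "x \<in> set (map (\<lambda>x. m + x) (map \<tau> [1..<Suc n])) \<longleftrightarrow> m < x"
      unfolding set_map[of "\<lambda>x. m + x"] permutes_map_upt(2)[OF \<tau>] .
  qed
  ultimately show ?thesis
    using True by (simp only: shuffle_perms_def mem_Collect_eq map_shift_perm subseq_distinct_iff_filter[OF L(1)])
qed (auto simp: shuffle_perms_def)

text \<open>One pair for each class: the representative whose first permutation is the identity,
  with that component left out.\<close>

definition canon :: "nat \<Rightarrow> (nat list \<times> (nat \<Rightarrow> nat)) set" where
  "canon k = {(M, \<sigma>). set M \<subseteq> {1..k} \<and> \<sigma> permutes {1..length M}}"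

text \<open>Cutting a word at \<open>j\<close> and sorting the values of the permutation into those \<open>\<le> j\<close> and those
  \<open>> j\<close> undoes the shuffle product.\<close>

lemma unshuffle:
  assumes "(W, \<rho>) \<in> canon k" "j \<le> length W"
  shows "\<exists>p\<in>canon k. \<exists>q\<in>canon k. length (fst p) = j \<and> length (fst q) = length W - j \<and>
    (\<forall>M \<sigma> N \<tau>. (M, \<sigma>) \<in> canon k \<longrightarrow> (N, \<tau>) \<in> canon k \<longrightarrow>
      ((M, \<sigma>) = p \<and> (N, \<tau>) = q \<longleftrightarrow>
        W = M @ N \<and> j = length M \<and> \<rho> \<in> shuffle_perms (length M) (length N) \<sigma> (shift_perm (length M) \<tau>)))"
proof -
  define n where "n = length W - j"
  have W: "length W = j + n" using assms(2) by (simp add: n_def)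
  have \<rho>: "\<rho> permutes {1..j+n}" "set W \<subseteq> {1..k}" using assms(1) W by (auto simp: canon_def)
  define L where "L = map \<rho> [1..<Suc (j+n)]"
  have L: "distinct L" "set L = {1..j+n}" unfolding L_def by (rule permutes_map_upt[OF \<rho>(1)])+
  have "distinct (filter (\<lambda>x. x \<le> j) L)" "set (filter (\<lambda>x. x \<le> j) L) = {1..j}"
    using L by auto
  from ex_permutes_map[OF this] obtain \<sigma>0 where
    \<sigma>0: "\<sigma>0 permutes {1..j}" "map \<sigma>0 [1..<Suc j] = filter (\<lambda>x. x \<le> j) L" by blast
  \<comment> \<open>The large values must be lowered by j to give a permutation of {1..n}; this
    undoes \<open>shift_perm\<close>.\<close>
  have "distinct (map (\<lambda>x. x - j) (filter (\<lambda>x. j < x) L))"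
    using L by (auto simp: distinct_map inj_on_def)
  moreover have "set (map (\<lambda>x. x - j) (filter (\<lambda>x. j < x) L)) = {1..n}"
  proof -
    have "set (map (\<lambda>x. x - j) (filter (\<lambda>x. j < x) L)) = (\<lambda>x. x - j) ` {Suc j..j + n}"
      using L by auto
    also have "\<dots> = {1..n}"
    proof (intro equalityI subsetI)
      fix x assume "x \<in> {1..n}"
      then show "x \<in> (\<lambda>x. x - j) ` {Suc j..j + n}" by (intro image_eqI[of _ _ "x + j"]) auto
    qed auto
    finally show ?thesis .
  qed
  ultimately obtain \<tau>0 where
    \<tau>0: "\<tau>0 permutes {1..n}" "map \<tau>0 [1..<Suc n] = map (\<lambda>x. x - j) (filter (\<lambda>x. j < x) L)"
    using ex_permutes_map by blast
  have add: "map (\<lambda>x. j + x) (map (\<lambda>x. x - j) (filter (\<lambda>x. j < x) L)) = filter (\<lambda>x. j < x) L"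
    unfolding map_map by (rule map_idI) auto
  have p: "(take j W, \<sigma>0) \<in> canon k" "(drop j W, \<tau>0) \<in> canon k"
    using \<sigma>0(1) \<tau>0(1) \<rho>(2) W by (auto simp: canon_def dest: in_set_takeD in_set_dropD)
  show ?thesis
  proof (rule bexI[OF _ p(1)], rule bexI[OF _ p(2)], intro conjI allI impI)
    fix M \<sigma> N \<tau> assume M: "(M, \<sigma>) \<in> canon k" and N: "(N, \<tau>) \<in> canon k"
    show "(M, \<sigma>) = (take j W, \<sigma>0) \<and> (N, \<tau>) = (drop j W, \<tau>0) \<longleftrightarrow>
        W = M @ N \<and> j = length M \<and> \<rho> \<in> shuffle_perms (length M) (length N) \<sigma> (shift_perm (length M) \<tau>)"
      (is "?l \<longleftrightarrow> ?r")
    proof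
      assume l: ?l
      have "\<rho> \<in> shuffle_perms j n \<sigma>0 (shift_perm j \<tau>0)"
        unfolding shuffle_perms_iff[OF \<sigma>0(1) \<tau>0(1)] \<sigma>0(2) \<tau>0(2) add using \<rho>(1) by (simp only: L_def)
      then show ?r using l W by simp
    next
      assume r: ?r
      then have j: "length M = j" "length N = n" using W by auto
      have s: "\<sigma> permutes {1..j}" "\<tau> permutes {1..n}" using M N j by (auto simp: canon_def)
      have e: "map \<sigma> [1..<Suc j] = filter (\<lambda>x. x \<le> j) L"
        "map (\<lambda>x. j + x) (map \<tau> [1..<Suc n]) = filter (\<lambda>x. j < x) L"
        using r shuffle_perms_iff[OF s] unfolding L_def j by blast+
      have "\<sigma> = \<sigma>0" by (rule permutes_eqI_map[OF s(1) \<sigma>0(1)]) (simp only: e \<sigma>0)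
      moreover have "map (\<lambda>x. x - j) (map (\<lambda>x. j + x) (map \<tau> [1..<Suc n])) = map \<tau> [1..<Suc n]"
        by (simp del: upt_Suc)
      then have "map \<tau> [1..<Suc n] = map \<tau>0 [1..<Suc n]" unfolding e(2) \<tau>0(2) ..
      then have "\<tau> = \<tau>0" by (rule permutes_eqI_map[OF s(2) \<tau>0(1)])
      ultimately show ?l using r by simp
    qed
  qed (use W in \<open>auto simp: n_def\<close>)
qed

section \<open>Classes of triples and their canonical representatives\<close>

lemma triples_id_iff: "(M, id, \<sigma>) \<in> triples k \<longleftrightarrow> (M, \<sigma>) \<in> canon k"
  by (auto simp: triples_def canon_def permutes_id)

lemma triple_equivI:
  assumes "(M, \<sigma>1, \<sigma>2) \<in> triples k" "(M', \<sigma>1', \<sigma>2') \<in> triples k" "length M' = length M"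
    "\<pi> permutes {1..length M}" "\<And>j. j \<in> {1..length M} \<Longrightarrow> M' ! (j - 1) = M ! (\<pi> j - 1)"
    "\<sigma>1' = inv_into UNIV \<pi> \<circ> \<sigma>1" "\<sigma>2' = inv_into UNIV \<pi> \<circ> \<sigma>2"
  shows "((M, \<sigma>1, \<sigma>2), (M', \<sigma>1', \<sigma>2')) \<in> triple_equiv k"
  using assms unfolding triple_equiv_def by blast

lemma triple_equivE:
  assumes "((M, \<sigma>1, \<sigma>2), (M', \<sigma>1', \<sigma>2')) \<in> triple_equiv k"
  obtains \<pi> where "(M, \<sigma>1, \<sigma>2) \<in> triples k" "(M', \<sigma>1', \<sigma>2') \<in> triples k" "length M' = length M"
    "\<pi> permutes {1..length M}" "\<And>j. j \<in> {1..length M} \<Longrightarrow> M' ! (j - 1) = M ! (\<pi> j - 1)"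
    "\<sigma>1' = inv_into UNIV \<pi> \<circ> \<sigma>1" "\<sigma>2' = inv_into UNIV \<pi> \<circ> \<sigma>2"
  using assms unfolding triple_equiv_def by blast

lemma equiv_triple_equiv: "equiv (triples k) (triple_equiv k)"
proof (rule equivI)
  show "triple_equiv k \<subseteq> triples k \<times> triples k" by (auto simp: triple_equiv_def)
  show "refl_on (triples k) (triple_equiv k)"
  proof (rule refl_onI)
    fix t assume t: "t \<in> triples k"
    show "(t, t) \<in> triple_equiv k"
      using t by (cases t) (auto intro!: triple_equivI[of _ _ _ _ _ _ _ id] simp: permutes_id inv_id)
  qed
  show "sym (triple_equiv k)"
  proof (rule symI, clarify)
    fix M \<sigma>1 \<sigma>2 M' \<sigma>1' \<sigma>2' assume "((M, \<sigma>1, \<sigma>2), (M', \<sigma>1', \<sigma>2')) \<in> triple_equiv k"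
    then obtain \<pi> where t: "(M, \<sigma>1, \<sigma>2) \<in> triples k" "(M', \<sigma>1', \<sigma>2') \<in> triples k"
      and len: "length M' = length M" and \<pi>: "\<pi> permutes {1..length M}"
      and M': "\<And>j. j \<in> {1..length M} \<Longrightarrow> M' ! (j - 1) = M ! (\<pi> j - 1)"
      and \<sigma>: "\<sigma>1' = inv_into UNIV \<pi> \<circ> \<sigma>1" "\<sigma>2' = inv_into UNIV \<pi> \<circ> \<sigma>2"
      by (rule triple_equivE) blast
    show "((M', \<sigma>1', \<sigma>2'), (M, \<sigma>1, \<sigma>2)) \<in> triple_equiv k"
    proof (rule triple_equivI[OF t(2,1) len[symmetric]])
      show "inv_into UNIV \<pi> permutes {1..length M'}" using permutes_inv[OF \<pi>] len by simp
      show "M ! (j - 1) = M' ! (inv_into UNIV \<pi> j - 1)" if "j \<in> {1..length M'}" for j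
      proof -
        have "inv_into UNIV \<pi> j \<in> {1..length M}"
          using that len permutes_in_image[OF permutes_inv[OF \<pi>]] by simp
        then show ?thesis using M' permutes_inverses(1)[OF \<pi>] by simp
      qed
      show "\<sigma>1 = inv_into UNIV (inv_into UNIV \<pi>) \<circ> \<sigma>1'" "\<sigma>2 = inv_into UNIV (inv_into UNIV \<pi>) \<circ> \<sigma>2'"
        unfolding \<sigma> permutes_inv_inv[OF \<pi>] using permutes_inverses(1)[OF \<pi>] by (simp_all add: fun_eq_iff)
    qed
  qed
  show "trans (triple_equiv k)"
  proof (rule transI, clarify)
    fix M \<sigma>1 \<sigma>2 M' \<sigma>1' \<sigma>2' M'' \<sigma>1'' \<sigma>2''
    assume a: "((M, \<sigma>1, \<sigma>2), (M', \<sigma>1', \<sigma>2')) \<in> triple_equiv k"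
      and b: "((M', \<sigma>1', \<sigma>2'), (M'', \<sigma>1'', \<sigma>2'')) \<in> triple_equiv k"
    from a obtain \<pi> where t: "(M, \<sigma>1, \<sigma>2) \<in> triples k"
      and len: "length M' = length M" and \<pi>: "\<pi> permutes {1..length M}"
      and M': "\<And>j. j \<in> {1..length M} \<Longrightarrow> M' ! (j - 1) = M ! (\<pi> j - 1)"
      and \<sigma>: "\<sigma>1' = inv_into UNIV \<pi> \<circ> \<sigma>1" "\<sigma>2' = inv_into UNIV \<pi> \<circ> \<sigma>2"
      by (rule triple_equivE) blast
    from b obtain \<pi>' where t'': "(M'', \<sigma>1'', \<sigma>2'') \<in> triples k"
      and len': "length M'' = length M'" and \<pi>': "\<pi>' permutes {1..length M'}"
      and M'': "\<And>j. j \<in> {1..length M'} \<Longrightarrow> M'' ! (j - 1) = M' ! (\<pi>' j - 1)"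
      and \<sigma>'': "\<sigma>1'' = inv_into UNIV \<pi>' \<circ> \<sigma>1'" "\<sigma>2'' = inv_into UNIV \<pi>' \<circ> \<sigma>2'"
      by (rule triple_equivE) blast
    have \<pi>'2: "\<pi>' permutes {1..length M}" using \<pi>' len by simp
    \<comment> \<open>Substituting one reindexing of letters into the other gives \<pi> (\<pi>' j),
      so the witness for transitivity is \<pi> \<circ> \<pi>' in this order.\<close>
    have inv: "inv_into UNIV (\<pi> \<circ> \<pi>') = inv_into UNIV \<pi>' \<circ> inv_into UNIV \<pi>"
      by (rule o_inv_distrib[OF permutes_bij[OF \<pi>] permutes_bij[OF \<pi>']])
    show "((M, \<sigma>1, \<sigma>2), (M'', \<sigma>1'', \<sigma>2'')) \<in> triple_equiv k"
    proof (rule triple_equivI[OF t t''])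
      show "length M'' = length M" using len len' by simp
      show "\<pi> \<circ> \<pi>' permutes {1..length M}" by (rule permutes_compose[OF \<pi>'2 \<pi>])
      show "M'' ! (j - 1) = M ! ((\<pi> \<circ> \<pi>') j - 1)" if "j \<in> {1..length M}" for j
        using M''[of j] M'[of "\<pi>' j"] that len permutes_in_image[OF \<pi>'2, of j] by simp
      show "\<sigma>1'' = inv_into UNIV (\<pi> \<circ> \<pi>') \<circ> \<sigma>1" "\<sigma>2'' = inv_into UNIV (\<pi> \<circ> \<pi>') \<circ> \<sigma>2"
        unfolding inv \<sigma>'' \<sigma> by (simp_all add: o_assoc)
    qed
  qed
qed

text \<open>Take \<pi> = \<sigma>1: the first permutation becomes the identity, and the letters of
  the word appear in the order in which \<sigma>1 lists their positions.\<close>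

lemma triple_equiv_canon:
  assumes "(M, \<sigma>1, \<sigma>2) \<in> triples k"
  obtains M' \<sigma> where "(M', \<sigma>) \<in> canon k" "length M' = length M"
    "((M, \<sigma>1, \<sigma>2), (M', id, \<sigma>)) \<in> triple_equiv k"
proof -
  have p: "\<sigma>1 permutes {1..length M}" "\<sigma>2 permutes {1..length M}" "set M \<subseteq> {1..k}"
    using assms by (auto simp: triples_def)
  define M' where "M' = map (\<lambda>j. M ! (\<sigma>1 j - 1)) [1..<Suc (length M)]"
  have len: "length M' = length M" by (simp add: M'_def del: upt_Suc)
  have "M ! (\<sigma>1 j - 1) \<in> set M" if "j \<in> {1..length M}" for j
    using that permutes_in_image[OF p(1), of j] by (intro nth_mem) auto
  then have "set M' \<subseteq> {1..k}" using p(3) by (auto simp: M'_def simp del: upt_Suc)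
  moreover have "inv_into UNIV \<sigma>1 \<circ> \<sigma>2 permutes {1..length M'}"
    unfolding len by (rule permutes_compose[OF p(2) permutes_inv[OF p(1)]])
  ultimately have c: "(M', inv_into UNIV \<sigma>1 \<circ> \<sigma>2) \<in> canon k" by (simp add: canon_def)
  moreover have "((M, \<sigma>1, \<sigma>2), (M', id, inv_into UNIV \<sigma>1 \<circ> \<sigma>2)) \<in> triple_equiv k"
  proof (rule triple_equivI[OF assms _ len p(1)])
    show "(M', id, inv_into UNIV \<sigma>1 \<circ> \<sigma>2) \<in> triples k" using c by (simp add: triples_id_iff)
    show "M' ! (j - 1) = M ! (\<sigma>1 j - 1)" if "j \<in> {1..length M}" for j
      using that by (auto simp: M'_def simp del: upt_Suc)
    show "id = inv_into UNIV \<sigma>1 \<circ> \<sigma>1" using permutes_inv_o(2)[OF p(1)] by simp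
  qed simp
  ultimately show thesis using that len by blast
qed

text \<open>Identities in the first place on both sides force \<pi> to be the identity, and then
  nothing else can change.\<close>

lemma triple_equiv_id_unique:
  assumes "((M, id, \<sigma>), (M', id, \<sigma>')) \<in> triple_equiv k"
  shows "(M, \<sigma>) = (M', \<sigma>')"
proof -
  from assms obtain \<pi> where len: "length M' = length M" and \<pi>: "\<pi> permutes {1..length M}"
      and M': "\<And>j. j \<in> {1..length M} \<Longrightarrow> M' ! (j - 1) = M ! (\<pi> j - 1)"
      and inv: "id = inv_into UNIV \<pi> \<circ> id" "\<sigma>' = inv_into UNIV \<pi> \<circ> \<sigma>"
    by (rule triple_equivE) blast
  then have "inv_into UNIV \<pi> = id" by simp
  then have "\<pi> = id" using permutes_inv_inv[OF \<pi>] by (simp add: inv_id)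
  moreover have "M' ! i = M ! i" if "i < length M" for i
    using M'[of "Suc i"] that \<open>\<pi> = id\<close> by simp
  ultimately show ?thesis using inv len by (auto simp: inv_id intro: nth_equalityI)
qed

lemma triple_class_eq_iff:
  assumes "(M, \<sigma>1, \<sigma>2) \<in> triples k" "(M', \<sigma>1', \<sigma>2') \<in> triples k"
  shows "triple_class k M \<sigma>1 \<sigma>2 = triple_class k M' \<sigma>1' \<sigma>2' \<longleftrightarrow>
    ((M, \<sigma>1, \<sigma>2), (M', \<sigma>1', \<sigma>2')) \<in> triple_equiv k"
  unfolding triple_class_def using eq_equiv_class_iff[OF equiv_triple_equiv assms] .

lemma triple_class_id_eq_iff:
  assumes "(M, \<sigma>) \<in> canon k" "(M', \<sigma>') \<in> canon k"
  shows "triple_class k M id \<sigma> = triple_class k M' id \<sigma>' \<longleftrightarrow> M = M' \<and> \<sigma> = \<sigma>'"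
  using triple_class_eq_iff[of M id \<sigma> k M' id \<sigma>'] assms triple_equiv_id_unique[of M \<sigma> M' \<sigma>' k]
  by (auto simp: triples_id_iff)

lemma triple_class_canon:
  assumes "(M, \<sigma>1, \<sigma>2) \<in> triples k"
  obtains M' \<sigma> where "(M', \<sigma>) \<in> canon k" "length M' = length M"
    "triple_class k M \<sigma>1 \<sigma>2 = triple_class k M' id \<sigma>"
  using triple_equiv_canon[OF assms] triple_class_eq_iff[OF assms] triples_id_iff by metis

text \<open>Basis elements carry classes rather than triples, so the degree is read from a chosen
  member; equivalence preserves the length of the word.\<close>

definition class_deg :: "triple set \<Rightarrow> nat" where
  "class_deg X = length (fst (SOME t. t \<in> X))"

lemma class_deg_triple_class:
  assumes "(M, \<sigma>1, \<sigma>2) \<in> triples k"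
  shows "class_deg (triple_class k M \<sigma>1 \<sigma>2) = length M"
proof -
  let ?X = "triple_class k M \<sigma>1 \<sigma>2"
  have "(M, \<sigma>1, \<sigma>2) \<in> ?X"
    unfolding triple_class_def using equiv_class_self[OF equiv_triple_equiv assms] .
  then have "(SOME t. t \<in> ?X) \<in> ?X" by (rule someI)
  then show ?thesis
    by (cases "SOME t. t \<in> ?X") (auto simp: class_deg_def triple_class_def elim: triple_equivE)
qed

lemma finite_canon: "finite {p \<in> canon k. length (fst p) \<le> n}"
proof (rule finite_subset)
  show "{p \<in> canon k. length (fst p) \<le> n} \<subseteq>
    {M. set M \<subseteq> {1..k} \<and> length M \<le> n} \<times> (\<Union>m\<in>{..n}. {\<sigma>. \<sigma> permutes {1..m}})"
    by (auto simp: canon_def)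
  show "finite ({M. set M \<subseteq> {1..k} \<and> length M \<le> n} \<times> (\<Union>m\<in>{..n}. {\<sigma>. \<sigma> permutes {1..m}}))"
    by (intro finite_cartesian_product finite_lists_length_le finite_UN_I finite_permutations) auto
qed

section \<open>The modules of symbols\<close>

lemma symbols_eq: "symbols k C = (\<lambda>(M, \<sigma>). (C, triple_class k M id \<sigma>)) ` canon k"
proof
  show "symbols k C \<subseteq> (\<lambda>(M, \<sigma>). (C, triple_class k M id \<sigma>)) ` canon k"
  proof
    fix s assume "s \<in> symbols k C"
    then obtain M \<sigma>1 \<sigma>2 where s: "(M, \<sigma>1, \<sigma>2) \<in> triples k" "s = (C, triple_class k M \<sigma>1 \<sigma>2)"
      by (auto simp: symbols_def quotient_def triple_class_def)
    from triple_class_canon[OF s(1)] s(2) show "s \<in> (\<lambda>(M, \<sigma>). (C, triple_class k M id \<sigma>)) ` canon k"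
      by (metis (mono_tags, lifting) case_prod_conv image_eqI)
  qed
  show "(\<lambda>(M, \<sigma>). (C, triple_class k M id \<sigma>)) ` canon k \<subseteq> symbols k C"
    by (auto simp: symbols_def quotient_def triple_class_def triples_id_iff[symmetric])
qed

lemma split_symbols_eq:
  "split_symbols k A B =
    {((A, B), triple_class k M id \<sigma>, i) | M \<sigma> i. (M, \<sigma>) \<in> canon k \<and> i \<le> length M}"
  (is "_ = ?R")
proof
  show "split_symbols k A B \<subseteq> ?R"
  proof
    fix s assume "s \<in> split_symbols k A B"
    then obtain M \<sigma>1 \<sigma>2 i where s: "(M, \<sigma>1, \<sigma>2) \<in> triples k" "s = ((A, B), triple_class k M \<sigma>1 \<sigma>2, i)"
      "i \<le> length M"
      by (auto simp: split_symbols_def)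
    obtain M' \<sigma> where "(M', \<sigma>) \<in> canon k" "length M' = length M"
      "triple_class k M \<sigma>1 \<sigma>2 = triple_class k M' id \<sigma>"
      using triple_class_canon[OF s(1)] .
    then have "s = ((A, B), triple_class k M' id \<sigma>, i) \<and> (M', \<sigma>) \<in> canon k \<and> i \<le> length M'"
      using s by simp
    then show "s \<in> ?R" by blast
  qed
  show "?R \<subseteq> split_symbols k A B"
    by (auto simp: split_symbols_def triples_id_iff[symmetric])
qed

lemma class_deg_canon: "(M, \<sigma>) \<in> canon k \<Longrightarrow> class_deg (triple_class k M id \<sigma>) = length M"
  by (simp add: class_deg_triple_class triples_id_iff)

abbreviation sym_deg :: "sym \<Rightarrow> nat" where
  "sym_deg s \<equiv> class_deg (snd s)"

abbreviation split_deg :: "split_sym \<Rightarrow> nat" where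
  "split_deg s \<equiv> class_deg (fst (snd s))"

text \<open>Each class of degree at most n has a representative in the finite set of
  \<open>finite_canon\<close>. The generators of \<open>deg_filt\<close> run over all triples and
  are matched with symbols through \<open>class_deg_triple_class\<close>.\<close>

lemma graded_R: "graded_free_group (symbols k C) sym_deg (deg_filt k C)"
proof
  fix n
  have "{s \<in> symbols k C. sym_deg s \<le> n} \<subseteq>
      (\<lambda>(M, \<sigma>). (C, triple_class k M id \<sigma>)) ` {p \<in> canon k. length (fst p) \<le> n}"
    by (auto simp: symbols_eq class_deg_canon)
  then show "finite {s \<in> symbols k C. sym_deg s \<le> n}"
    using finite_canon finite_surj by blast
  have "{r_sym k C M \<sigma>1 \<sigma>2 | M \<sigma>1 \<sigma>2. (M, \<sigma>1, \<sigma>2) \<in> triples k \<and> length M > n} =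
      frag_of ` {s \<in> symbols k C. n < sym_deg s}"
    (is "?L = ?R")
  proof (intro equalityI subsetI)
    fix g assume "g \<in> ?L"
    then obtain M \<sigma>1 \<sigma>2 where t: "(M, \<sigma>1, \<sigma>2) \<in> triples k" "n < length M" "g = r_sym k C M \<sigma>1 \<sigma>2" by blast
    then have "(C, triple_class k M \<sigma>1 \<sigma>2) \<in> {s \<in> symbols k C. n < sym_deg s}"
      by (simp add: class_deg_triple_class symbols_def) (simp add: triple_class_def quotientI)
    then show "g \<in> ?R" using t(3) by (simp add: r_sym_def)
  next
    fix g assume "g \<in> ?R"
    then obtain s where s: "s \<in> symbols k C" "n < sym_deg s" "g = frag_of s" by blast
    then obtain M \<sigma>1 \<sigma>2 where t: "(M, \<sigma>1, \<sigma>2) \<in> triples k" "s = (C, triple_class k M \<sigma>1 \<sigma>2)"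
      by (auto simp: symbols_def quotient_def triple_class_def)
    then have "n < length M \<and> g = r_sym k C M \<sigma>1 \<sigma>2"
      using s by (simp add: class_deg_triple_class r_sym_def)
    then show "g \<in> ?L" using t(1) by blast
  qed
  then show "deg_filt k C n = generate (Free k C) (frag_of ` {s \<in> symbols k C. n < sym_deg s})"
    by (simp add: deg_filt_def)
qed

lemma graded_RAB: "graded_free_group (split_symbols k A B) split_deg (deg_filt_split k A B)"
proof
  fix n
  \<comment> \<open>The cut index is at most the length of the word, hence at most n, so the set
    stays finite.\<close>
  have "{s \<in> split_symbols k A B. split_deg s \<le> n} \<subseteq>
      (\<lambda>((M, \<sigma>), i). ((A, B), triple_class k M id \<sigma>, i)) ` ({p \<in> canon k. length (fst p) \<le> n} \<times> {..n})"
    by (fastforce simp: split_symbols_eq class_deg_canon image_iff)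
  then show "finite {s \<in> split_symbols k A B. split_deg s \<le> n}"
    by (rule finite_subset) (intro finite_imageI finite_cartesian_product finite_canon finite_atMost)
  have "{r_split_sym k i A B M \<sigma>1 \<sigma>2 | i M \<sigma>1 \<sigma>2.
        (M, \<sigma>1, \<sigma>2) \<in> triples k \<and> i \<le> length M \<and> length M > n} =
      frag_of ` {s \<in> split_symbols k A B. n < split_deg s}"
    (is "?L = ?R")
  proof (intro equalityI subsetI)
    fix g assume "g \<in> ?L"
    then obtain i M \<sigma>1 \<sigma>2 where t: "(M, \<sigma>1, \<sigma>2) \<in> triples k" "i \<le> length M" "n < length M"
      "g = r_split_sym k i A B M \<sigma>1 \<sigma>2" by blast
    then have "((A, B), triple_class k M \<sigma>1 \<sigma>2, i) \<in> split_symbols k A B"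
      unfolding split_symbols_def by blast
    then have "((A, B), triple_class k M \<sigma>1 \<sigma>2, i) \<in> {s \<in> split_symbols k A B. n < split_deg s}"
      using t by (simp add: class_deg_triple_class)
    then show "g \<in> ?R" using t(4) by (simp add: r_split_sym_def)
  next
    fix g assume "g \<in> ?R"
    then obtain s where s: "s \<in> split_symbols k A B" "n < split_deg s" "g = frag_of s" by blast
    then obtain M \<sigma>1 \<sigma>2 i where t: "(M, \<sigma>1, \<sigma>2) \<in> triples k" "i \<le> length M"
      "s = ((A, B), triple_class k M \<sigma>1 \<sigma>2, i)"
      unfolding split_symbols_def by blast
    then have "n < length M \<and> g = r_split_sym k i A B M \<sigma>1 \<sigma>2"
      using s by (simp add: class_deg_triple_class r_split_sym_def)
    then show "g \<in> ?L" using t(1,2) by blast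
  qed
  then show "deg_filt_split k A B n =
      generate (Free_split k A B) (frag_of ` {s \<in> split_symbols k A B. n < split_deg s})"
    by (simp add: deg_filt_split_def)
qed

section \<open>Evaluation of the two sides\<close>

abbreviation RAB_series :: "nat \<Rightarrow> rect \<Rightarrow> rect \<Rightarrow> (split_sym \<Rightarrow> int) \<Rightarrow> nat \<Rightarrow> (split_sym \<Rightarrow>\<^sub>0 int) set" where
  "RAB_series k A B \<equiv> graded_free_group.series (split_symbols k A B) split_deg (deg_filt_split k A B)"

lemma symbols_canonI: "(M, \<sigma>) \<in> canon k \<Longrightarrow> (C, triple_class k M id \<sigma>) \<in> symbols k C"
  by (auto simp: symbols_eq)

lemma split_symbols_canonI:
  "\<lbrakk>(M, \<sigma>) \<in> canon k; i \<le> length M\<rbrakk> \<Longrightarrow> ((A, B), triple_class k M id \<sigma>, i) \<in> split_symbols k A B"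
  by (auto simp: split_symbols_eq)

text \<open>The map is exhibited by its coefficients and recognised as \<open>incl\<close> through
  uniqueness; in that form it can be evaluated at an infinite sum.\<close>

lemma incl_J_sum: "incl k A B (J_sum k (join1 A B)) = RAB_series k A B (\<lambda>_. 1)"
proof -
  let ?C = "join1 A B"
  interpret RC: graded_free_group "symbols k ?C" sym_deg "deg_filt k ?C" by (rule graded_R)
  interpret RS: graded_free_group "split_symbols k A B" split_deg "deg_filt_split k A B"
    by (rule graded_RAB)
  \<comment> \<open>The prescribed values read backwards: a split symbol occurs in the image of just
    one symbol, the one with the same class, and occurs there once. So its coefficient is that of
    the class, whatever the cut index.\<close>
  define f where "f = (\<lambda>z\<in>carrier (R_mod k ?C). RS.series (\<lambda>s. RC.coeff z (?C, fst (snd s))))"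
  have sym: "(?C, fst (snd s)) \<in> symbols k ?C" if "s \<in> split_symbols k A B" for s
    using that by (auto simp: split_symbols_eq symbols_canonI)
  have f: "f \<in> cont_linear (Free k ?C) (deg_filt k ?C) (Free_split k A B) (deg_filt_split k A B)"
    unfolding f_def
  proof (rule RS.series_cont_linear[OF RC.fg.filtered_group_axioms])
    fix s assume s: "s \<in> split_symbols k A B"
    show "(\<lambda>z. RC.coeff z (?C, fst (snd s))) \<in> hom (R_mod k ?C) integer_group"
      using sym[OF s] by (intro homI) (simp_all add: RC.coeff_mult)
    show "RC.coeff x (?C, fst (snd s)) = RC.coeff y (?C, fst (snd s))"
      if "x (split_deg s) = y (split_deg s)" for x y
      using that by (intro RC.coeff_local) simp
  qed
  have keys: "Poly_Mapping.keys (\<Sum>j\<in>{0..length M}. r_split_sym k j A B M id \<sigma>) \<subseteq> split_symbols k A B"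
    if "(M, \<sigma>) \<in> canon k" for M \<sigma>
  proof -
    have "(\<Sum>j\<in>{0..length M}. r_split_sym k j A B M id \<sigma>) \<in> carrier (Free_split k A B)"
      using that by (intro sum_closed_free_Abelian_group) (simp add: r_split_sym_def split_symbols_canonI)
    then show ?thesis by simp
  qed
  have val: "f (in_R k ?C (r_sym k ?C M id \<sigma>)) =
      in_RAB k A B (\<Sum>j\<in>{0..length M}. r_split_sym k j A B M id \<sigma>)"
    if M: "(M, \<sigma>) \<in> canon k" for M \<sigma>
  proof -
    have keysM: "Poly_Mapping.keys (r_sym k ?C M id \<sigma>) \<subseteq> symbols k ?C"
      using M by (simp add: r_sym_def symbols_canonI)
    then have cl: "in_R k ?C (r_sym k ?C M id \<sigma>) \<in> carrier (R_mod k ?C)"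
      by (intro RC.fg.to_completion_closed) simp
    have "RS.series (\<lambda>s. RC.coeff (in_R k ?C (r_sym k ?C M id \<sigma>)) (?C, fst (snd s))) =
      in_RAB k A B (\<Sum>j\<in>{0..length M}. r_split_sym k j A B M id \<sigma>)"
    proof (rule RS.completion_eqI[OF RS.series_closed RS.fg.to_completion_closed])
      show "(\<Sum>j\<in>{0..length M}. r_split_sym k j A B M id \<sigma>) \<in> carrier (Free_split k A B)"
        using keys[OF M] by simp
      fix s assume s: "s \<in> split_symbols k A B"
      then obtain N \<tau> i where N: "(N, \<tau>) \<in> canon k" "i \<le> length N"
        "s = ((A, B), triple_class k N id \<tau>, i)" by (auto simp: split_symbols_eq)
      have "Poly_Mapping.lookup (r_sym k ?C M id \<sigma>) (?C, fst (snd s)) =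
          (if N = M \<and> \<tau> = \<sigma> then 1 else 0)"
        using triple_class_id_eq_iff[OF N(1) M] by (simp add: r_sym_def N(3))
      \<comment> \<open>Only j = i contributes, and it lies in the range because i \<le>
        \<open>length N\<close>, which is \<open>length M\<close> when the classes match.\<close>
      moreover have "Poly_Mapping.lookup (\<Sum>j\<in>{0..length M}. r_split_sym k j A B M id \<sigma>) s =
          (\<Sum>j\<in>{0..length M}. if j = i then (if N = M \<and> \<tau> = \<sigma> then 1 else 0) else 0)"
        unfolding lookup_sum
        using triple_class_id_eq_iff[OF N(1) M] by (intro sum.cong) (auto simp: r_split_sym_def N(3))
      ultimately show "RS.coeff (RS.series (\<lambda>s. RC.coeff (in_R k ?C (r_sym k ?C M id \<sigma>)) (?C, fst (snd s)))) s =
          RS.coeff (in_RAB k A B (\<Sum>j\<in>{0..length M}. r_split_sym k j A B M id \<sigma>)) s"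
        using N(2) by (auto simp add: RS.coeff_series[OF s] RC.coeff_to_completion[OF keysM sym[OF s]]
            RS.coeff_to_completion[OF keys[OF M] s])
    qed
    then show ?thesis using cl by (simp add: f_def)
  qed
  have "incl k A B = f"
    unfolding incl_def
  proof (rule the_equality)
    show "f \<in> cont_linear (Free k ?C) (deg_filt k ?C) (Free_split k A B) (deg_filt_split k A B) \<and>
      (\<forall>M \<sigma>2. (M, id, \<sigma>2) \<in> triples k \<longrightarrow> f (in_R k ?C (r_sym k ?C M id \<sigma>2)) =
        in_RAB k A B (\<Sum>j\<in>{0..length M}. r_split_sym k j A B M id \<sigma>2))"
      using f val by (simp add: triples_id_iff)
    fix g assume g: "g \<in> cont_linear (Free k ?C) (deg_filt k ?C) (Free_split k A B) (deg_filt_split k A B) \<and>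
      (\<forall>M \<sigma>2. (M, id, \<sigma>2) \<in> triples k \<longrightarrow> g (in_R k ?C (r_sym k ?C M id \<sigma>2)) =
        in_RAB k A B (\<Sum>j\<in>{0..length M}. r_split_sym k j A B M id \<sigma>2))"
    show "g = f"
    proof (rule RC.cont_linear_unique_frag[OF RS.fg.filtered_group_axioms conjunct1[OF g] f])
      fix s assume "s \<in> symbols k ?C"
      then obtain M \<sigma> where "(M, \<sigma>) \<in> canon k" "frag_of s = r_sym k ?C M id \<sigma>"
        by (auto simp: symbols_eq r_sym_def)
      then show "g (in_R k ?C (frag_of s)) = f (in_R k ?C (frag_of s))"
        using g val by (simp add: triples_id_iff)
    qed
  qed
  moreover have "RS.series (\<lambda>s. RC.coeff (RC.series (\<lambda>_. 1)) (?C, fst (snd s))) = RS.series (\<lambda>_. 1)"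
    by (rule RS.completion_eqI[OF RS.series_closed RS.series_closed])
      (simp add: RS.coeff_series RC.coeff_series[OF sym])
  ultimately show ?thesis
    by (simp add: f_def J_sum_def RC.completion_sum_eq_series RC.series_closed)
qed

text \<open>\<open>unshuffle\<close> singles out the one pair of symbols that can produce s, so the
  coefficient at s is a single product of coefficients, as in \<open>ex_coeff_functional\<close>. On
  the two sums it is 1 times 1. All properties are bundled for one functional because the next lemma
  chooses it.\<close>

lemma ex_times1_coefficient:
  assumes s: "s \<in> split_symbols k A B"
  shows "\<exists>\<Lambda> \<in> hom (completion (tensor (R_mod k A) (R_mod k B)) (tensor_RR_filt k A B)) integer_group.
    (\<forall>z z'. z (split_deg s) = z' (split_deg s) \<longrightarrow> \<Lambda> z = \<Lambda> z') \<and>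
    (\<forall>M \<sigma> N \<tau>. (M, \<sigma>) \<in> canon k \<longrightarrow> (N, \<tau>) \<in> canon k \<longrightarrow>
      \<Lambda> (ctensor k A B (in_R k A (r_sym k A M id \<sigma>)) (in_R k B (r_sym k B N id \<tau>))) =
      Poly_Mapping.lookup (\<Sum>\<rho> \<in> shuffle_perms (length M) (length N) \<sigma> (shift_perm (length M) \<tau>).
             r_split_sym k (length M) A B (M @ N) id \<rho>) s) \<and>
    \<Lambda> (ctensor k A B (J_sum k A) (J_sum k B)) = 1"
proof -
  interpret graded_pair "symbols k A" sym_deg "deg_filt k A" "symbols k B" sym_deg "deg_filt k B"
    by (intro graded_pair.intro graded_R)
  obtain W \<rho> j where W: "(W, \<rho>) \<in> canon k" "j \<le> length W" "s = ((A, B), triple_class k W id \<rho>, j)"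
    using s unfolding split_symbols_eq by blast
  from unshuffle[OF W(1,2)] obtain p q where pq: "p \<in> canon k" "length (fst p) = j"
    "q \<in> canon k" "length (fst q) = length W - j"
    "\<And>M \<sigma> N \<tau>. \<lbrakk>(M, \<sigma>) \<in> canon k; (N, \<tau>) \<in> canon k\<rbrakk> \<Longrightarrow>
      (M, \<sigma>) = p \<and> (N, \<tau>) = q \<longleftrightarrow>
        W = M @ N \<and> j = length M \<and> \<rho> \<in> shuffle_perms (length M) (length N) \<sigma> (shift_perm (length M) \<tau>)"
    by blast
  obtain P \<sigma>P where p: "p = (P, \<sigma>P)" by (cases p)
  obtain Q \<tau>Q where q: "q = (Q, \<tau>Q)" by (cases q)
  have P: "(P, \<sigma>P) \<in> canon k" "length P = j" and Q: "(Q, \<tau>Q) \<in> canon k" "length Q = length W - j"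
    using pq(1-4) unfolding p q by simp_all
  have cut: "(M, \<sigma>) = (P, \<sigma>P) \<and> (N, \<tau>) = (Q, \<tau>Q) \<longleftrightarrow>
      W = M @ N \<and> j = length M \<and> \<rho> \<in> shuffle_perms (length M) (length N) \<sigma> (shift_perm (length M) \<tau>)"
    if "(M, \<sigma>) \<in> canon k" "(N, \<tau>) \<in> canon k" for M \<sigma> N \<tau>
    using pq(5)[OF that] unfolding p q .
  let ?a = "(A, triple_class k P id \<sigma>P)" and ?b = "(B, triple_class k Q id \<tau>Q)"
  have ds: "split_deg s = length W" using W by (simp add: class_deg_canon)
  \<comment> \<open>The pieces have lengths j and \<open>length W - j\<close>, both at most the
    degree of s, so level \<open>split_deg s\<close> shows both coefficients.\<close>
  have ab: "?a \<in> symbols k A" "sym_deg ?a \<le> split_deg s" "?b \<in> symbols k B" "sym_deg ?b \<le> split_deg s"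
    using P Q W(2) by (simp_all add: symbols_canonI class_deg_canon ds)
  have ct: "ctensor k A B x y = ctens x y" for x y by (simp add: ctensor_def tensor_RR_filt_def)
  from ex_coeff_functional[OF ab] obtain \<Lambda> where \<Lambda>: "\<Lambda> \<in> hom CT integer_group"
    "\<And>x y. \<lbrakk>x \<in> carrier CA; y \<in> carrier CB\<rbrakk> \<Longrightarrow> \<Lambda> (ctensor k A B x y) = A.coeff x ?a * B.coeff y ?b"
    "\<And>z z'. z (split_deg s) = z' (split_deg s) \<Longrightarrow> \<Lambda> z = \<Lambda> z'"
    unfolding ct by blast
  have val: "\<Lambda> (ctensor k A B (inA (r_sym k A M id \<sigma>)) (inB (r_sym k B N id \<tau>))) =
      Poly_Mapping.lookup (\<Sum>\<rho> \<in> shuffle_perms (length M) (length N) \<sigma> (shift_perm (length M) \<tau>).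
             r_split_sym k (length M) A B (M @ N) id \<rho>) s"
    if M: "(M, \<sigma>) \<in> canon k" and N: "(N, \<tau>) \<in> canon k" for M \<sigma> N \<tau>
  proof -
    let ?sh = "shuffle_perms (length M) (length N) \<sigma> (shift_perm (length M) \<tau>)"
    have keys: "Poly_Mapping.keys (r_sym k A M id \<sigma>) \<subseteq> symbols k A"
      "Poly_Mapping.keys (r_sym k B N id \<tau>) \<subseteq> symbols k B"
      using M N by (simp_all add: r_sym_def symbols_canonI)
    have val: "\<Lambda> (ctensor k A B (inA (r_sym k A M id \<sigma>)) (inB (r_sym k B N id \<tau>))) =
      Poly_Mapping.lookup (r_sym k A M id \<sigma>) ?a * Poly_Mapping.lookup (r_sym k B N id \<tau>) ?b"
      using \<Lambda>(2)[OF A.fg.to_completion_closed B.fg.to_completion_closed] keys ab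
      by (simp add: A.coeff_to_completion B.coeff_to_completion)
    also have "\<dots> = (if (M, \<sigma>) = (P, \<sigma>P) \<and> (N, \<tau>) = (Q, \<tau>Q) then 1 else 0)"
      using triple_class_id_eq_iff[OF P(1) M] triple_class_id_eq_iff[OF Q(1) N]
      by (auto simp: r_sym_def)
    \<comment> \<open>Uniqueness of the cut turns a condition on the two factors into a condition on
      their shuffle product.\<close>
    also have "\<dots> = (if W = M @ N \<and> j = length M \<and> \<rho> \<in> ?sh then 1 else 0)"
      unfolding cut[OF M N] ..
    also have "\<dots> = (\<Sum>\<rho>'\<in>?sh. if \<rho>' = \<rho> then (if W = M @ N \<and> j = length M then 1 else 0) else 0)"
    proof -
      \<comment> \<open>Finiteness matters: \<open>sum\<close> over an infinite set would be 0 by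
        default.\<close>
      have "?sh \<subseteq> {\<rho>. \<rho> permutes {1..length M + length N}}" by (auto simp: shuffle_perms_def)
      then have "finite ?sh" by (rule finite_subset) (simp add: finite_permutations)
      then show ?thesis by simp
    qed
    also have "\<dots> = (\<Sum>\<rho>'\<in>?sh. Poly_Mapping.lookup (r_split_sym k (length M) A B (M @ N) id \<rho>') s)"
    proof (intro sum.cong refl)
      fix \<rho>' assume "\<rho>' \<in> ?sh"
      then have "(M @ N, \<rho>') \<in> canon k" using M N by (auto simp: canon_def shuffle_perms_def)
      then show "(if \<rho>' = \<rho> then (if W = M @ N \<and> j = length M then 1 else 0) else 0) =
          Poly_Mapping.lookup (r_split_sym k (length M) A B (M @ N) id \<rho>') s"
        using triple_class_id_eq_iff[OF W(1)] by (auto simp: r_split_sym_def W(3))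
    qed
    finally show ?thesis by (simp add: lookup_sum)
  qed
  have J: "\<Lambda> (ctensor k A B (J_sum k A) (J_sum k B)) = 1"
    using ab by (simp add: J_sum_def A.completion_sum_eq_series B.completion_sum_eq_series
        \<Lambda>(2) A.series_closed B.series_closed A.coeff_series B.coeff_series)
  show ?thesis
    unfolding tensor_RR_filt_def
    by (intro bexI[OF _ \<Lambda>(1)] conjI allI impI) (fact \<Lambda>(3) val J)+
qed

text \<open>One functional is chosen for each split symbol, and the choices are assembled into a
  continuous map. The value on the tensor of the two sums is kept among the chosen properties, since
  in general it does not follow from the prescribed values by finite bilinearity.\<close>

lemma times1_J_sum: "times1 k A B (ctensor k A B (J_sum k A) (J_sum k B)) = RAB_series k A B (\<lambda>_. 1)"
proof -
  interpret graded_pair "symbols k A" sym_deg "deg_filt k A" "symbols k B" sym_deg "deg_filt k B"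
    by (intro graded_pair.intro graded_R)
  interpret RS: graded_free_group "split_symbols k A B" split_deg "deg_filt_split k A B"
    by (rule graded_RAB)
  have Tf: "tensor_RR_filt k A B = Tf" by (simp add: tensor_RR_filt_def)
  have ct: "ctensor k A B x y = ctens x y" for x y by (simp add: ctensor_def tensor_RR_filt_def)
  let ?sum = "\<lambda>M \<sigma> N \<tau>. \<Sum>\<rho> \<in> shuffle_perms (length M) (length N) \<sigma> (shift_perm (length M) \<tau>).
    r_split_sym k (length M) A B (M @ N) id \<rho>"
  define Q where "Q s L \<longleftrightarrow> L \<in> hom CT integer_group \<and>
      (\<forall>z z'. z (split_deg s) = z' (split_deg s) \<longrightarrow> L z = L z') \<and>
      (\<forall>M \<sigma> N \<tau>. (M, \<sigma>) \<in> canon k \<longrightarrow> (N, \<tau>) \<in> canon k \<longrightarrow>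
        L (ctensor k A B (inA (r_sym k A M id \<sigma>)) (inB (r_sym k B N id \<tau>))) =
        Poly_Mapping.lookup (?sum M \<sigma> N \<tau>) s) \<and>
      L (ctensor k A B (J_sum k A) (J_sum k B)) = 1" for s L
  have "\<forall>s\<in>split_symbols k A B. \<exists>L. Q s L"
  proof
    fix s assume "s \<in> split_symbols k A B"
    from ex_times1_coefficient[OF this] show "\<exists>L. Q s L"
      unfolding Q_def Tf Bex_def .
  qed
  from bchoice[OF this] obtain \<Lambda> where Q: "\<And>s. s \<in> split_symbols k A B \<Longrightarrow> Q s (\<Lambda> s)" by blast
  note \<Lambda> = Q[unfolded Q_def]
  define f where "f = (\<lambda>z\<in>carrier CT. RS.series (\<lambda>s. \<Lambda> s z))"
  have f: "f \<in> cont_linear (tensor CA CB) Tf (Free_split k A B) (deg_filt_split k A B)"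
    unfolding f_def
  proof (rule RS.series_cont_linear[OF ft.filtered_group_axioms])
    fix s assume s: "s \<in> split_symbols k A B"
    show "\<Lambda> s \<in> hom CT integer_group" using \<Lambda>[OF s] by (rule conjunct1)
    show "\<Lambda> s x = \<Lambda> s y" if "x (split_deg s) = y (split_deg s)" for x y
      using \<Lambda>[OF s] that by blast
  qed
  have val: "f (ctensor k A B (inA (r_sym k A M id \<sigma>)) (inB (r_sym k B N id \<tau>))) =
      in_RAB k A B (?sum M \<sigma> N \<tau>)"
    if M: "(M, \<sigma>) \<in> canon k" and N: "(N, \<tau>) \<in> canon k" for M \<sigma> N \<tau>
  proof -
    let ?z = "ctensor k A B (inA (r_sym k A M id \<sigma>)) (inB (r_sym k B N id \<tau>))"
    have "inA (r_sym k A M id \<sigma>) \<in> carrier CA" "inB (r_sym k B N id \<tau>) \<in> carrier CB"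
      using M N by (auto intro!: A.fg.to_completion_closed B.fg.to_completion_closed
          simp: r_sym_def symbols_canonI)
    then have z: "?z \<in> carrier CT" unfolding ct by (rule ctens_closed)
    have "?sum M \<sigma> N \<tau> \<in> carrier (Free_split k A B)"
    proof (rule sum_closed_free_Abelian_group)
      fix \<rho> assume "\<rho> \<in> shuffle_perms (length M) (length N) \<sigma> (shift_perm (length M) \<tau>)"
      then have "(M @ N, \<rho>) \<in> canon k" using M N by (auto simp: canon_def shuffle_perms_def)
      then show "r_split_sym k (length M) A B (M @ N) id \<rho> \<in> carrier (Free_split k A B)"
        by (simp add: r_split_sym_def split_symbols_canonI)
    qed
    then have keys: "Poly_Mapping.keys (?sum M \<sigma> N \<tau>) \<subseteq> split_symbols k A B" by simp
    have "RS.series (\<lambda>s. \<Lambda> s ?z) = in_RAB k A B (?sum M \<sigma> N \<tau>)"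
    proof (rule RS.completion_eqI[OF RS.series_closed RS.fg.to_completion_closed])
      show "?sum M \<sigma> N \<tau> \<in> carrier (Free_split k A B)" by fact
      fix s assume s: "s \<in> split_symbols k A B"
      have "\<Lambda> s ?z = Poly_Mapping.lookup (?sum M \<sigma> N \<tau>) s" using \<Lambda>[OF s] M N by blast
      then show "RS.coeff (RS.series (\<lambda>s. \<Lambda> s ?z)) s = RS.coeff (in_RAB k A B (?sum M \<sigma> N \<tau>)) s"
        by (simp only: RS.coeff_series[OF s] RS.coeff_to_completion[OF keys s])
    qed
    then show ?thesis using z by (simp add: f_def)
  qed
  have "times1 k A B = f"
    unfolding times1_def Tf
  proof (rule the_equality)
    show "f \<in> cont_linear (tensor CA CB) Tf (Free_split k A B) (deg_filt_split k A B) \<and>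
      (\<forall>M \<sigma> N \<tau>. (M, id, \<sigma>) \<in> triples k \<and> (N, id, \<tau>) \<in> triples k \<longrightarrow>
        f (ctensor k A B (inA (r_sym k A M id \<sigma>)) (inB (r_sym k B N id \<tau>))) = in_RAB k A B (?sum M \<sigma> N \<tau>))"
      using f val by (simp add: triples_id_iff)
    fix g assume g: "g \<in> cont_linear (tensor CA CB) Tf (Free_split k A B) (deg_filt_split k A B) \<and>
      (\<forall>M \<sigma> N \<tau>. (M, id, \<sigma>) \<in> triples k \<and> (N, id, \<tau>) \<in> triples k \<longrightarrow>
        g (ctensor k A B (inA (r_sym k A M id \<sigma>)) (inB (r_sym k B N id \<tau>))) = in_RAB k A B (?sum M \<sigma> N \<tau>))"
    \<comment> \<open>Every symbol has a canonical representative, so the prescribed values cover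
      all of \<open>pure_gens\<close>, whose span is dense.\<close>
    show "g = f"
    proof (rule ft.cont_linear_unique[OF RS.fg.filtered_group_axioms conjunct1[OF g] f pure_gens_subset])
      fix d assume "d \<in> pure_gens"
      then obtain s t where st: "s \<in> symbols k A" "t \<in> symbols k B" "d = ctens (inA (frag_of s)) (inB (frag_of t))"
        by (auto simp: pure_gens_def)
      obtain M \<sigma> where M: "(M, \<sigma>) \<in> canon k" "frag_of s = r_sym k A M id \<sigma>"
        using st(1) by (auto simp: symbols_eq r_sym_def)
      obtain N \<tau> where N: "(N, \<tau>) \<in> canon k" "frag_of t = r_sym k B N id \<tau>"
        using st(2) by (auto simp: symbols_eq r_sym_def)
      show "g d = f d"
        unfolding st(3) M(2) N(2) ct[symmetric] val[OF M(1) N(1)] using g M(1) N(1) by (simp add: triples_id_iff)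
    qed (rule pure_gens_dense)
  qed
  moreover have "RS.series (\<lambda>s. \<Lambda> s (ctensor k A B (J_sum k A) (J_sum k B))) = RS.series (\<lambda>_. 1)"
  proof (rule RS.completion_eqI[OF RS.series_closed RS.series_closed])
    fix s assume s: "s \<in> split_symbols k A B"
    have "\<Lambda> s (ctensor k A B (J_sum k A) (J_sum k B)) = 1" using \<Lambda>[OF s] by blast
    then show "RS.coeff (RS.series (\<lambda>s. \<Lambda> s (ctensor k A B (J_sum k A) (J_sum k B)))) s =
        RS.coeff (RS.series (\<lambda>_. 1)) s"
      by (simp add: RS.coeff_series[OF s])
  qed
  moreover have "ctensor k A B (J_sum k A) (J_sum k B) \<in> carrier CT"
    unfolding ct J_sum_def A.completion_sum_eq_series B.completion_sum_eq_series
    by (rule ctens_closed[OF A.series_closed B.series_closed])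
  ultimately show ?thesis by (simp add: f_def)
qed

theorem theorem1p13:
  fixes a1 b1 c1 a2 b2 :: real and A B :: rect and k :: nat and \<alpha> :: "nat \<Rightarrow> two_form"
  assumes "a1 < b1" and "b1 < c1" and "a2 < b2"
    and "A = Rect a1 b1 a2 b2" and "B = Rect b1 c1 a2 b2"
    and "\<And>j. j \<in> {1..k} \<Longrightarrow> continuous_on (rect_set (join1 A B)) (\<alpha> j)"
    and "\<And>C M \<sigma>1 \<sigma>2. \<lbrakk>C \<in> {A, B, join1 A B}; (M, \<sigma>1, \<sigma>2) \<in> triples k\<rbrakk> \<Longrightarrow>
           I_int \<alpha> C M \<sigma>1 \<sigma>2 \<noteq> 0"
    and "\<And>i M \<sigma>1 \<sigma>2. \<lbrakk>(M, \<sigma>1, \<sigma>2) \<in> triples k; i \<le> length M\<rbrakk> \<Longrightarrow>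
           I_split \<alpha> i A B M \<sigma>1 \<sigma>2 \<noteq> 0"
  shows "incl k A B (J_sum k (join1 A B)) = times1 k A B (ctensor k A B (J_sum k A) (J_sum k B))"
  by (simp only: incl_J_sum times1_J_sum)

end
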